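(* Let $\lambda=(\lambda_1,\dots,\lambda_m)$ be a partition of length $m$ and let $n\ge m$. Then $$Q_\lambda(1^n)=2^{\frac12 m(2n+1-m)}\prod_{i=1}^m\frac{1}{(n-m+i-1)!}\prod_{1\le i<j\le m}\frac{1}{\lambda_i+\lambda_j}\ \det_{1\le i,j\le m}\left(f_{n+m-2j}(\lambda_i)\right).$$
   Context: A partition of length $m$ is a sequence of integers $\lambda_1\ge\lambda_2\ge\dots\ge\lambda_m>0$. For $m\le n$, the Schur $Q$-polynomial is the symmetric polynomial $$Q_\lambda(x_1,\dots,x_n)=2^m\sum_{\sigma\in S_n/S_{n-m}}\sigma\Bigg(x_1^{\lambda_1}\cdots x_m^{\lambda_m}\prod_{\substack{1\le i\le m\\ i<j\le n}}\frac{x_i+x_j}{x_i-x_j}\Bigg),$$ where $S_n$ acts by permuting $x_1,\dots,x_n$ and $S_{n-m}$ is the subgroup permuting $x_{m+1},\dots,x_n$. $Q_\lambda(1^n)$ is its value at $x_1=\dots=x_n=1$. For $k\ge0$, $$f_k(x)=\frac{(k+1)!}{2^k}\,{}_2F_1\left[\begin{matrix}-k,\,1-x\\2\end{matrix};2\right]=\frac{(k+1)!}{2^k}\sum_{j=0}^k\frac{(-k)_j(1-x)_j}{(2)_j\,j!}\,2^j,$$ where $(a)_j=a(a+1)\cdots(a+j-1)$. *)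

theory Defs
  imports
    Complex_Main
    "HOL-Library.Poly_Mapping"
    "HOL-Computational_Algebra.Polynomial_Factorial"
    "HOL-Algebra.Sym_Groups"
    "HOL-Algebra.Left_Coset"
    "Jordan_Normal_Form.Determinant"
begin

text \<open>Parts are indexed from 1; the values of \<open>lam\<close> outside \<open>{1..m}\<close> are irrelevant.\<close>

definition is_partition :: "nat \<Rightarrow> (nat \<Rightarrow> nat) \<Rightarrow> bool" where
  "is_partition m lam \<longleftrightarrow>
     (\<forall>i\<in>{1..m}. 0 < lam i) \<and> (\<forall>i\<in>{1..<m}. lam (i + 1) \<le> lam i)"

text \<open>
  Polynomials over the reals in variables \<open>x\<^sub>0, x\<^sub>1, x\<^sub>2, \<dots>\<close>, of which only
  \<open>x\<^sub>1, \<dots>, x\<^sub>n\<close> are used. The keys are the exponent vectors.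
\<close>

type_synonym rpoly = "(nat \<Rightarrow>\<^sub>0 nat) \<Rightarrow>\<^sub>0 real"

definition Var :: "nat \<Rightarrow> rpoly" where
  "Var i = Poly_Mapping.single (Poly_Mapping.single i 1) 1"

definition eval_rpoly :: "rpoly \<Rightarrow> (nat \<Rightarrow> real) \<Rightarrow> real" where
  "eval_rpoly p a =
     (\<Sum>e\<in>Poly_Mapping.keys p. Poly_Mapping.lookup p e *
        (\<Prod>i\<in>Poly_Mapping.keys e. a i ^ Poly_Mapping.lookup e i))"

definition Q_summand ::
  "nat \<Rightarrow> nat \<Rightarrow> (nat \<Rightarrow> nat) \<Rightarrow> (nat \<Rightarrow> 'f::field) \<Rightarrow> 'f" where
  "Q_summand m n lam x =
     (\<Prod>i\<in>{1..m}. x i ^ lam i) *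
     (\<Prod>i\<in>{1..m}. \<Prod>j\<in>{i<..n}. (x i + x j) / (x i - x j))"

abbreviation tail_perms :: "nat \<Rightarrow> nat \<Rightarrow> (nat \<Rightarrow> nat) set" where
  "tail_perms m n \<equiv> {\<rho>. \<rho> permutes {m+1..n}}"

text \<open>
  The sum defining the Schur \<open>Q\<close>-polynomial, in the fraction field of the polynomial
  ring: \<open>\<sigma>\<close> acts by \<open>x\<^sub>i \<mapsto> x\<^bsub>\<sigma>(i)\<^esub>\<close>, and one representative is taken from
  each left coset of \<open>tail_perms m n\<close> in the symmetric group. The choice does not
  matter, see \<open>Q_summand_coset\<close> below.
\<close>

definition schur_Q_fract :: "nat \<Rightarrow> nat \<Rightarrow> (nat \<Rightarrow> nat) \<Rightarrow> rpoly fract" where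
  "schur_Q_fract m n lam =
     2 ^ m * (\<Sum>C\<in>lcosets\<^bsub>sym_group n\<^esub> (tail_perms m n).
                Q_summand m n lam (\<lambda>i. to_fract (Var ((SOME \<sigma>. \<sigma> \<in> C) i))))"

text \<open>
  The polynomial itself; it is unique because \<open>to_fract\<close> is injective.
  The substitution \<open>x\<^sub>1 = \<dots> = x\<^sub>n = 1\<close> has to be made here, as the individual summands
  of \<open>schur_Q_fract\<close> have a pole there.
\<close>

definition schur_Q :: "nat \<Rightarrow> nat \<Rightarrow> (nat \<Rightarrow> nat) \<Rightarrow> rpoly" where
  "schur_Q m n lam = (THE p. to_fract p = schur_Q_fract m n lam)"

definition hyp2F1 :: "real \<Rightarrow> real \<Rightarrow> real \<Rightarrow> real \<Rightarrow> real" where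
  "hyp2F1 a b c z =
     suminf (\<lambda>j. pochhammer a j * pochhammer b j / (pochhammer c j * fact j) * z ^ j)"

definition f_poly :: "nat \<Rightarrow> real \<Rightarrow> real" where
  "f_poly k x = fact (k + 1) / 2 ^ k * hyp2F1 (- real k) (1 - x) 2 2"

text \<open>The series terminates, since its first parameter is a nonpositive integer.\<close>

lemma f_poly_eq_sum:
  "f_poly k x = fact (k + 1) / 2 ^ k *
     (\<Sum>j=0..k. pochhammer (- real k) j * pochhammer (1 - x) j /
                 (pochhammer 2 j * fact j) * 2 ^ j)"
  unfolding f_poly_def hyp2F1_def
  by (subst suminf_finite[of "{0..k}"]) (auto simp: pochhammer_of_nat_eq_0_iff)

lemma Q_summand_stabilizer:
  assumes "\<rho> permutes {m+1..n}"
  shows "Q_summand m n lam (\<lambda>i. x (\<rho> i)) = Q_summand m n lam x"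
proof -
  have fix_head: "\<rho> i = i" if "i \<in> {1..m}" for i
    using that permutes_not_in[OF assms] by auto
  have "(\<Prod>j\<in>{i<..n}. (x (\<rho> i) + x (\<rho> j)) / (x (\<rho> i) - x (\<rho> j)))
      = (\<Prod>j\<in>{i<..n}. (x i + x j) / (x i - x j))" (is "?L i = ?R i") if i: "i \<in> {1..m}" for i
  proof -
    have "\<rho> permutes {i<..n}"
      using i by (intro permutes_subset[OF assms]) auto
    then show ?thesis
      using prod.permute[of \<rho> "{i<..n}" "\<lambda>j. (x i + x j) / (x i - x j)"]
      by (simp add: fix_head[OF i] o_def)
  qed
  then have "(\<Prod>i\<in>{1..m}. ?L i) = (\<Prod>i\<in>{1..m}. ?R i)"
    by (rule prod.cong[OF refl])
  moreover have "(\<Prod>i\<in>{1..m}. x (\<rho> i) ^ lam i) = (\<Prod>i\<in>{1..m}. x i ^ lam i)"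
    by (rule prod.cong[OF refl]) (simp only: fix_head)
  ultimately show ?thesis
    unfolding Q_summand_def by (simp only:)
qed

lemma Q_summand_coset:
  assumes "C \<in> lcosets\<^bsub>sym_group n\<^esub> (tail_perms m n)" "\<sigma> \<in> C" "\<tau> \<in> C"
  shows "Q_summand m n lam (\<lambda>i. x (\<sigma> i)) = Q_summand m n lam (\<lambda>i. x (\<tau> i))"
proof -
  from assms(1) obtain \<pi> where C: "C = (\<lambda>\<rho>. \<pi> \<circ> \<rho>) ` tail_perms m n"
    by (auto simp: LCOSETS_def l_coset_def sym_group_def)
  have "Q_summand m n lam (\<lambda>i. x (\<kappa> i)) = Q_summand m n lam (\<lambda>i. x (\<pi> i))"
    if "\<kappa> \<in> C" for \<kappa>
  proof -
    from that obtain \<rho> where "\<rho> permutes {m+1..n}" "\<kappa> = \<pi> \<circ> \<rho>"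
      unfolding C by auto
    then show ?thesis
      using Q_summand_stabilizer[of \<rho> m n lam "\<lambda>i. x (\<pi> i)"] by simp
  qed
  then show ?thesis using assms(2,3) by metis
qed

end

theory Submission
  imports Defs
begin

text \<open>
  Put \<open>w\<^sub>k = 2 \<Prod>\<^bsub>j \<noteq> k\<^esub> (x\<^sub>k + x\<^sub>j) / (x\<^sub>k - x\<^sub>j)\<close> and \<open>K(y, z) = (z - y) / (z + y)\<close>. Distributing the factors of the
  definition over the points used gives
  \<open>Q\<^sub>\<lambda> = \<Sum> \<Prod>\<^sub>i w\<^bsub>s(i)\<^esub> x\<^bsub>s(i)\<^esub>\<^bsup>\<lambda>(i)\<^esup> \<Prod>\<^bsub>i<j\<^esub> K(x\<^bsub>s(i)\<^esub>, x\<^bsub>s(j)\<^esub>)\<close>, where \<open>s\<close> runs over the injective maps from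
  \<open>{1..m}\<close> to \<open>{1..n}\<close>. Since \<open>K(y, y) = 0\<close>, it may run over all maps
  (\<open>coset_sum_eq_weighted_sum\<close>). By Schur's identity (\<open>schur_pfaffian\<close>) the product of the kernels is
  a Pfaffian, and a Pfaffian is multilinear, so \<open>Q\<^sub>\<lambda>\<close> is the Pfaffian of the sums for two parts
  (\<open>coset_sum_eq_pfaffian\<close>); for odd \<open>m\<close> a point \<open>0\<close> is added.

  The sums for one part and for two parts obey recursions without division, \<open>schur_q\<close> and \<open>schur_q2\<close>.
  This shows that \<open>Q\<^sub>\<lambda>\<close> is a polynomial and evaluates it at \<open>1\<^sup>n\<close> without any limit
  (\<open>schur_Q_eq_pfaffian\<close>, \<open>eval_schur_Q\<close>). There the sum for one part \<open>r\<close> is \<open>2 c\<^sub>n(r)\<close>, where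
  \<open>c\<^bsub>k+1\<^esub>\<close> is \<open>f\<^sub>k\<close> up to a constant factor (\<open>f_poly_eq_cayley_coeff\<close>), and the sum for two parts is
  \<open>4 (a c\<^sub>n(a) c\<^bsub>n-1\<^esub>(b) - b c\<^sub>n(b) c\<^bsub>n-1\<^esub>(a)) / (a + b)\<close> (\<open>schur_q2_at_1\<close>).

  So the entries of the Pfaffian are \<open>2 \<times> 2\<close> minors \<open>a\<^sub>i b\<^sub>j - a\<^sub>j b\<^sub>i\<close> divided by \<open>x\<^sub>i + x\<^sub>j\<close>. The main algebraic
  fact (\<open>two_block_det_eq_pfaffian\<close>) is that such a Pfaffian, multiplied by \<open>\<Prod>\<^bsub>i<j\<^esub> (x\<^sub>i + x\<^sub>j)\<close>, is,
  for an even number of rows, the determinant with the rows \<open>a\<^sub>i, b\<^sub>i, x\<^sub>i\<^sup>2 a\<^sub>i, x\<^sub>i\<^sup>2 b\<^sub>i, \<dots>\<close>. It also contains Schur's identity, with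
  \<open>a\<^sub>i = 1\<close> and \<open>b\<^sub>i = x\<^sub>i\<close>. It is proved by interpolation in the first entry of one row.
  Finally the three-term recurrence of \<open>c\<^sub>k\<close> turns that determinant into the one of the theorem by
  triangular changes of columns (\<open>rowdet_cayley_coeff_reduction\<close>).
\<close>

section \<open>Determinants whose rows are indexed by a list\<close>

definition drop_nth :: "nat \<Rightarrow> 'b list \<Rightarrow> 'b list" where
  "drop_nth k zs = take k zs @ drop (Suc k) zs"

lemma length_drop_nth [simp]: "k < length zs \<Longrightarrow> length (drop_nth k zs) = length zs - 1"
  by (simp add: drop_nth_def)

lemma drop_nth_Cons_0 [simp]: "drop_nth 0 (z # zs) = zs"
  by (simp add: drop_nth_def)

lemma drop_nth_Cons_Suc [simp]: "drop_nth (Suc k) (z # zs) = z # drop_nth k zs"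
  by (simp add: drop_nth_def)

lemma map_drop_nth: "map f (drop_nth k zs) = drop_nth k (map f zs)"
  by (simp add: drop_nth_def take_map drop_map)

lemma mset_drop_nth: "k < length zs \<Longrightarrow> mset zs = add_mset (zs ! k) (mset (drop_nth k zs))"
  by (simp add: drop_nth_def)
    (metis id_take_nth_drop mset.simps(2) mset_append union_mset_add_mset_right)

lemma set_drop_nth_subset: "set (drop_nth k zs) \<subseteq> set zs"
  unfolding drop_nth_def using set_take_subset set_drop_subset by fastforce

lemma nth_in_drop_nth:
  "l < length zs \<Longrightarrow> l \<noteq> k \<Longrightarrow> zs ! l \<in> set (drop_nth k zs)"
proof (induction zs arbitrary: k l)
  case (Cons z zs)
  then show ?case by (cases k; cases l) auto
qed simp

text \<open>
  Rows are indexed by the entries of a list, so that deleting and moving rows become list operations.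
\<close>

definition rowdet :: "('z \<Rightarrow> nat \<Rightarrow> 'a :: comm_ring_1) \<Rightarrow> 'z list \<Rightarrow> 'a" where
  "rowdet \<phi> zs = det (mat (length zs) (length zs) (\<lambda>(i, c). \<phi> (zs ! i) c))"

lemma rowdet_Nil [simp]: "rowdet \<phi> [] = 1"
  by (simp add: rowdet_def)

lemma rowdet_cong:
  assumes "\<And>z c. z \<in> set zs \<Longrightarrow> c < length zs \<Longrightarrow> \<phi> z c = \<psi> z c"
  shows "rowdet \<phi> zs = rowdet \<psi> zs"
  unfolding rowdet_def by (rule arg_cong[of _ _ det]) (auto intro!: eq_matI simp: assms)

lemma rowdet_map: "rowdet \<phi> (map f zs) = rowdet (\<lambda>z. \<phi> (f z)) zs"
  unfolding rowdet_def by (rule arg_cong[of _ _ det]) (auto intro!: eq_matI)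

lemma rowdet_change_columns:
  assumes "\<And>z c. z \<in> set zs \<Longrightarrow> c < length zs \<Longrightarrow>
             \<phi> z c = (\<Sum>d<length zs. \<psi> z d * T d c)"
  shows "rowdet \<phi> zs = rowdet \<psi> zs * det (mat (length zs) (length zs) (\<lambda>(d, c). T d c))"
proof -
  let ?n = "length zs"
  have "mat ?n ?n (\<lambda>(i, c). \<phi> (zs ! i) c) =
          mat ?n ?n (\<lambda>(i, c). \<psi> (zs ! i) c) * mat ?n ?n (\<lambda>(d, c). T d c)"
    by (rule eq_matI) (auto simp: assms scalar_prod_def atLeast0LessThan)
  then show ?thesis
    unfolding rowdet_def by (simp add: det_mult[where n = ?n])
qed

lemma rowdet_upper_columns:
  assumes "\<And>z c. z \<in> set zs \<Longrightarrow> c < length zs \<Longrightarrow>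
             \<phi> z c = (\<Sum>d<length zs. \<psi> z d * T d c)"
    and "\<And>d c. c < d \<Longrightarrow> T d c = 0"
  shows "rowdet \<phi> zs = rowdet \<psi> zs * (\<Prod>c<length zs. T c c)"
proof -
  have "det (mat (length zs) (length zs) (\<lambda>(d, c). T d c)) = (\<Prod>c<length zs. T c c)"
    by (subst det_upper_triangular[where n = "length zs"])
       (auto simp: assms(2) prod_list_diag_prod atLeast0LessThan)
  with rowdet_change_columns[of zs \<phi> \<psi> T, OF assms(1)] show ?thesis by simp
qed

lemma rowdet_lower_columns:
  assumes "\<And>z c. z \<in> set zs \<Longrightarrow> c < length zs \<Longrightarrow>
             \<phi> z c = (\<Sum>d<length zs. \<psi> z d * T d c)"
    and "\<And>d c. d < c \<Longrightarrow> T d c = 0"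
  shows "rowdet \<phi> zs = rowdet \<psi> zs * (\<Prod>c<length zs. T c c)"
proof -
  have "det (mat (length zs) (length zs) (\<lambda>(d, c). T d c)) = (\<Prod>c<length zs. T c c)"
    by (subst det_lower_triangular[where n = "length zs"])
       (auto simp: assms(2) prod_list_diag_prod atLeast0LessThan)
  with rowdet_change_columns[of zs \<phi> \<psi> T, OF assms(1)] show ?thesis by simp
qed

lemma prod_list_map_nth: "(\<Prod>z\<leftarrow>zs. f z) = (\<Prod>i<length zs. f (zs ! i))"
  for f :: "'z \<Rightarrow> 'a :: comm_monoid_mult"
  by (subst map_nth[symmetric, of zs], subst map_map, subst prod.list_conv_set_nth)
    (auto simp: atLeast0LessThan)

lemma rowdet_scale_rows:
  assumes "\<And>z c. z \<in> set zs \<Longrightarrow> c < length zs \<Longrightarrow> \<phi> z c = s z * \<psi> z c"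
  shows "rowdet \<phi> zs = (\<Prod>z\<leftarrow>zs. s z) * rowdet \<psi> zs"
proof -
  let ?n = "length zs"
  let ?a = "\<lambda>i. vec ?n (\<lambda>c. \<psi> (zs ! i) c)"
  have "mat ?n ?n (\<lambda>(i, c). \<phi> (zs ! i) c) = mat\<^sub>r ?n ?n (\<lambda>i. s (zs ! i) \<cdot>\<^sub>v ?a i)"
    by (rule eq_matI) (auto simp: assms)
  moreover have "mat ?n ?n (\<lambda>(i, c). \<psi> (zs ! i) c) = mat\<^sub>r ?n ?n ?a"
    by (rule eq_matI) auto
  ultimately show ?thesis
    unfolding rowdet_def
    by (simp add: det_rows_mul prod_list_map_nth atLeast0LessThan)
qed

lemma rowdet_swap_adjacent:
  "rowdet \<phi> (us @ y # z # ws) = - rowdet \<phi> (us @ z # y # ws)"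
proof -
  let ?zs = "us @ z # y # ws" and ?n = "length (us @ z # y # ws)" and ?k = "length us"
  let ?A = "mat ?n ?n (\<lambda>(i, c). \<phi> (?zs ! i) c)"
  have "mat ?n ?n (\<lambda>(i, c). \<phi> ((us @ y # z # ws) ! i) c) = swaprows ?k (Suc ?k) ?A"
    by (rule eq_matI) (auto simp: nth_append nth_Cons split: nat.splits)
  moreover have "det (swaprows ?k (Suc ?k) ?A) = - det ?A"
    by (rule det_swaprows[where n = ?n]) auto
  ultimately show ?thesis
    unfolding rowdet_def by simp
qed

lemma rowdet_move_row:
  assumes "k < length zs"
  shows "rowdet \<phi> (us @ zs ! k # drop_nth k zs) = (-1) ^ k * rowdet \<phi> (us @ zs)"
  using assms
proof (induction k arbitrary: us zs)
  case 0
  then show ?case by (cases zs) auto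
next
  case (Suc k)
  then obtain v vs where zs: "zs = v # vs" by (cases zs) auto
  have "rowdet \<phi> (us @ vs ! k # v # drop_nth k vs) = - rowdet \<phi> ((us @ [v]) @ vs ! k # drop_nth k vs)"
    using rowdet_swap_adjacent[of \<phi> us "vs ! k" v "drop_nth k vs"] by simp
  also have "\<dots> = - ((-1) ^ k * rowdet \<phi> ((us @ [v]) @ vs))"
    using Suc zs by (subst Suc.IH) auto
  finally show ?case by (simp add: zs)
qed

lemma rowdet_rev: "rowdet \<phi> (us @ rev zs) = (-1) ^ (length zs * (length zs - 1) div 2) * rowdet \<phi> (us @ zs)"
proof (induction zs arbitrary: us)
  case (Cons z zs)
  let ?m = "length zs"
  have "drop_nth ?m (rev zs @ [z]) = rev zs" "(rev zs @ [z]) ! ?m = z"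
    by (simp_all add: drop_nth_def nth_append)
  then have "rowdet \<phi> (us @ z # rev zs) = (-1) ^ ?m * rowdet \<phi> (us @ rev (z # zs))"
    using rowdet_move_row[of ?m "rev zs @ [z]" \<phi> us] by simp
  then have "rowdet \<phi> (us @ rev (z # zs)) = (-1) ^ ?m * rowdet \<phi> ((us @ [z]) @ rev zs)"
    by (simp flip: power_add mult.assoc add: mult_2[symmetric])
  also have "\<dots> = (-1) ^ (?m + ?m * (?m - 1) div 2) * rowdet \<phi> (us @ z # zs)"
    by (subst Cons.IH) (simp add: power_add)
  also have "?m + ?m * (?m - 1) div 2 = length (z # zs) * (length (z # zs) - 1) div 2"
    by (cases ?m) (auto simp: algebra_simps)
  finally show ?case .
qed simp

lemma rowdet_reverse_columns:
  "rowdet (\<lambda>z c. \<phi> z (length zs - 1 - c)) zs =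
     (-1) ^ (length zs * (length zs - 1) div 2) * rowdet \<phi> zs"
proof -
  let ?m = "length zs"
  have transpose: "rowdet \<phi> zs = rowdet (\<lambda>c i. \<phi> (zs ! i) c) [0..<?m]" for \<phi> :: "'b \<Rightarrow> nat \<Rightarrow> 'a"
  proof -
    have "(mat ?m ?m (\<lambda>(i, c). \<phi> (zs ! i) c))\<^sup>T = mat ?m ?m (\<lambda>(c, i). \<phi> (zs ! i) ([0..<?m] ! c))"
      by (rule eq_matI) auto
    then show ?thesis
      unfolding rowdet_def by (subst det_transpose[of _ ?m, symmetric]) auto
  qed
  have "rowdet (\<lambda>z c. \<phi> z (?m - 1 - c)) zs = rowdet (\<lambda>c i. \<phi> (zs ! i) (?m - 1 - c)) [0..<?m]"
    by (rule transpose)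
  also have "\<dots> = rowdet (\<lambda>c i. \<phi> (zs ! i) c) (map (\<lambda>c. ?m - 1 - c) [0..<?m])"
    by (simp add: rowdet_map)
  also have "map (\<lambda>c. ?m - 1 - c) [0..<?m] = rev [0..<?m]"
    by (rule nth_equalityI) (auto simp: rev_nth)
  also have "rowdet (\<lambda>c i. \<phi> (zs ! i) c) (rev [0..<?m]) =
      (-1) ^ (?m * (?m - 1) div 2) * rowdet (\<lambda>c i. \<phi> (zs ! i) c) [0..<?m]"
    using rowdet_rev[of _ "[]" "[0..<?m]"] by simp
  finally show ?thesis by (simp add: transpose)
qed

lemma rowdet_block_triangular:
  fixes \<phi> :: "'z \<Rightarrow> nat \<Rightarrow> 'a :: idom"
  assumes "\<And>u c. u \<in> set us \<Longrightarrow> length us \<le> c \<Longrightarrow> \<phi> u c = 0"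
  shows "rowdet \<phi> (us @ ws) = rowdet \<phi> us * rowdet (\<lambda>w c. \<phi> w (length us + c)) ws"
proof -
  let ?p = "length us" and ?q = "length ws"
  let ?B = "mat ?q ?p (\<lambda>(i, c). \<phi> (ws ! i) c)"
  have "mat (?p + ?q) (?p + ?q) (\<lambda>(i, c). \<phi> ((us @ ws) ! i) c) =
     four_block_mat (mat ?p ?p (\<lambda>(i, c). \<phi> (us ! i) c)) (0\<^sub>m ?p ?q) ?B
       (mat ?q ?q (\<lambda>(i, c). \<phi> (ws ! i) (?p + c)))"
    by (rule eq_matI) (auto simp: nth_append assms)
  then show ?thesis
    unfolding rowdet_def by (simp add: det_four_block_mat_upper_right_zero[where n = ?p and m = ?q])
qed

lemma rowdet_linear_in_first_row:
  obtains C :: "nat \<Rightarrow> 'a :: comm_ring_1"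
  where "\<And>z. rowdet \<phi> (z # zs) = (\<Sum>c<Suc (length zs). \<phi> z c * C c)"
proof
  fix z
  let ?n = "Suc (length zs)"
  let ?A = "\<lambda>z. mat ?n ?n (\<lambda>(i, c). \<phi> ((z # zs) ! i) c)"
  have "mat_delete (?A z) 0 c = mat_delete (?A undefined) 0 c" for c
    unfolding mat_delete_def by (rule eq_matI) auto
  then have "cofactor (?A z) 0 c = cofactor (?A undefined) 0 c" for c
    by (simp add: cofactor_def)
  then show "rowdet \<phi> (z # zs) = (\<Sum>c<?n. \<phi> z c * cofactor (?A undefined) 0 c)"
    unfolding rowdet_def by (simp add: laplace_expansion_row[where i = 0 and n = ?n])
qed

lemma (in comm_ring_hom) hom_rowdet: "hom (rowdet \<phi> zs) = rowdet (\<lambda>z c. hom (\<phi> z c)) zs"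
proof -
  have "map_mat hom (mat (length zs) (length zs) (\<lambda>(i, c). \<phi> (zs ! i) c)) =
        mat (length zs) (length zs) (\<lambda>(i, c). hom (\<phi> (zs ! i) c))"
    by (rule eq_matI) auto
  then show ?thesis
    unfolding rowdet_def by (metis hom_det)
qed

fun pair_prod :: "('b \<Rightarrow> 'b \<Rightarrow> 'a :: comm_monoid_mult) \<Rightarrow> 'b list \<Rightarrow> 'a" where
  "pair_prod f [] = 1"
| "pair_prod f (z # zs) = (\<Prod>w\<leftarrow>zs. f z w) * pair_prod f zs"

text \<open>
  Subtracting \<open>y\<close> times the preceding column from each column reduces the first row to its first
  entry and takes the factor \<open>z - y\<close> out of every other row.
\<close>

lemma rowdet_Vandermonde:
  "rowdet (\<lambda>y c. y ^ c) ys = pair_prod (\<lambda>y z. z - y) ys" for ys :: "'a :: idom list"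
proof (induction ys)
  case (Cons y ys)
  let ?T = "\<lambda>d c. if d = c then 1 else if c = d + 1 then - y else 0"
  let ?\<phi> = "\<lambda>z c. if c = 0 then 1 else z ^ (c - 1) * (z - y)"
  have "rowdet ?\<phi> (y # ys) = rowdet (\<lambda>y c. y ^ c) (y # ys) *
          (\<Prod>c<length (y # ys). ?T c c)"
  proof (rule rowdet_upper_columns[where T = ?T])
    fix z c assume c: "c < length (y # ys)"
    have "(\<Sum>d<length (y # ys). z ^ d * ?T d c) =
          (\<Sum>d\<in>{d. d = c \<or> c = d + 1}. z ^ d * ?T d c)"
      using c by (intro sum.mono_neutral_right) auto
    also have "{d. d = c \<or> c = d + 1} = (if c = 0 then {0} else {c - 1, c})"
      by auto
    finally show "?\<phi> z c =
      (\<Sum>d<length (y # ys). z ^ d * ?T d c)"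
      by (cases c) (auto simp: algebra_simps)
  qed auto
  then have "rowdet (\<lambda>y c. y ^ c) (y # ys) = rowdet ?\<phi> ([y] @ ys)"
    by simp
  also have "\<dots> = rowdet ?\<phi> [y] * rowdet (\<lambda>z c. ?\<phi> z (length [y] + c)) ys"
    by (rule rowdet_block_triangular) auto
  also have "rowdet ?\<phi> [y] = 1"
    by (simp add: rowdet_def det_single)
  also have "rowdet (\<lambda>z c. ?\<phi> z (length [y] + c)) ys =
      (\<Prod>z\<leftarrow>ys. z - y) * rowdet (\<lambda>z c. z ^ c) ys"
    by (rule rowdet_scale_rows) auto
  finally show ?case by (simp add: Cons.IH)
qed simp

section \<open>Pfaffians and Schur's identity\<close>

text \<open>
  The Pfaffian of the skew-symmetric matrix \<open>M\<close>, by expansion along the first row.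
  On a list of odd length it is \<open>0\<close>.
\<close>

function pfaffian :: "('z \<Rightarrow> 'z \<Rightarrow> 'a :: comm_ring_1) \<Rightarrow> 'z list \<Rightarrow> 'a" where
  "pfaffian M [] = 1"
| "pfaffian M (z # zs) =
     (\<Sum>k<length zs. (-1) ^ k * M z (zs ! k) * pfaffian M (drop_nth k zs))"
  by pat_completeness auto
termination
  by (relation "measure (\<lambda>(M, zs). length zs)") auto

lemma sorted_wrt_drop_nth: "sorted_wrt P zs \<Longrightarrow> sorted_wrt P (drop_nth k zs)"
proof (induction zs arbitrary: k)
  case (Cons z zs)
  then show ?case
    by (cases k) (use set_drop_nth_subset in fastforce)+
qed (simp add: drop_nth_def)

lemma pfaffian_cong:
  assumes "sorted_wrt (\<lambda>y z. M y z = M' y z) zs"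
  shows "pfaffian M zs = pfaffian M' zs"
  using assms
proof (induction M zs rule: pfaffian.induct)
  case (2 M z zs)
  have "pfaffian M (drop_nth k zs) = pfaffian M' (drop_nth k zs)" if "k < length zs" for k
    using that 2 by (simp add: sorted_wrt_drop_nth)
  with 2 show ?case by (auto intro!: sum.cong)
qed simp

lemma pfaffian_map: "pfaffian M (map f zs) = pfaffian (\<lambda>y z. M (f y) (f z)) zs"
  by (induction "\<lambda>y z. M (f y) (f z)" zs rule: pfaffian.induct)
    (auto simp: map_drop_nth[symmetric] intro!: sum.cong)

lemma (in comm_ring_hom) hom_pfaffian: "hom (pfaffian M zs) = pfaffian (\<lambda>y z. hom (M y z)) zs"
  by (induction M zs rule: pfaffian.induct) (auto simp: hom_distribs intro!: sum.cong)

lemma pfaffian_scale: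
  assumes "even (length zs)"
  shows "pfaffian (\<lambda>y z. c * M y z) zs = c ^ (length zs div 2) * pfaffian M zs"
  using assms
proof (induction M zs rule: pfaffian.induct)
  case (2 M z zs)
  have "pfaffian (\<lambda>y z. c * M y z) (drop_nth k zs) =
          c ^ ((length zs - 1) div 2) * pfaffian M (drop_nth k zs)" if "k < length zs" for k
    using that 2 by simp
  moreover have "length (z # zs) div 2 = Suc ((length zs - 1) div 2)"
    using "2.prems" by (cases zs) auto
  ultimately show ?case
    by (auto simp: sum_distrib_left mult_ac intro!: sum.cong)
qed simp

lemma pair_prod_drop_nth:
  assumes "k < length zs" and "\<And>y z. f y z = f z y"
  shows "pair_prod f zs = (\<Prod>w\<leftarrow>drop_nth k zs. f (zs ! k) w) * pair_prod f (drop_nth k zs)"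
  using assms(1)
proof (induction zs arbitrary: k)
  case (Cons z zs)
  show ?case
  proof (cases k)
    case (Suc l)
    with Cons.prems have l: "l < length zs" by simp
    have "(\<Prod>w\<leftarrow>zs. f z w) = f z (zs ! l) * (\<Prod>w\<leftarrow>drop_nth l zs. f z w)"
      using arg_cong[OF mset_drop_nth[OF l], of "\<lambda>S. prod_mset (image_mset (f z) S)"]
      by (simp add: prod_mset_prod_list flip: mset_map)
    then show ?thesis
      using Cons.IH[OF l] assms(2)[of z "zs ! l"] by (simp add: Suc mult_ac)
  qed simp
qed simp

lemma pair_prod_cong:
  assumes "sorted_wrt (\<lambda>y z. f y z = g y z) zs"
  shows "pair_prod f zs = pair_prod g zs"
  using assms by (induction zs) (auto cong: map_cong)

lemma pair_prod_map: "pair_prod f (map g zs) = pair_prod (\<lambda>y z. f (g y) (g z)) zs"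
  by (induction zs) (auto simp: comp_def)

lemma pair_prod_mult: "pair_prod (\<lambda>y z. f y z * g y z) zs = pair_prod f zs * pair_prod g zs"
  by (induction zs) (auto simp: mult_ac prod_list_map_nth prod.distrib)

lemma rowdet_pair: "rowdet \<phi> [y, z] = \<phi> y 0 * \<phi> z 1 - \<phi> y 1 * \<phi> z 0"
proof -
  let ?A = "mat 2 2 (\<lambda>(i, c). \<phi> ([y, z] ! i) c)"
  have "det ?A = (\<Sum>c<2. ?A $$ (0, c) * cofactor ?A 0 c)"
    by (rule laplace_expansion_row) auto
  also have "\<dots> = \<phi> y 0 * \<phi> z 1 - \<phi> y 1 * \<phi> z 0"
    by (simp add: numeral_2_eq_2 cofactor_def det_single mat_delete_def)
  finally show ?thesis by (simp add: rowdet_def numeral_2_eq_2)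
qed

text \<open>
  A row is given by a triple \<open>(x, a, b)\<close>. It reads \<open>a, b, x\<^sup>2 a, x\<^sup>2 b, x\<^sup>4 a, x\<^sup>4 b, \<dots>\<close>.
\<close>

definition two_block_row :: "'a \<times> 'a \<times> 'a \<Rightarrow> nat \<Rightarrow> 'a :: comm_ring_1" where
  "two_block_row = (\<lambda>(x, a, b) c. x ^ (2 * (c div 2)) * (if even c then a else b))"

text \<open>
  When the first two rows have the same first entry, subtracting \<open>y\<^sup>2\<close> times the column two places to
  the left clears them beyond their first two columns. These are the values needed at the
  interpolation nodes below.
\<close>

lemma two_block_det_equal_x:
  fixes y :: "'a :: idom"
  shows "rowdet two_block_row ((y, a, b) # (y, a', b') # ws) =
     (a * b' - a' * b) * (\<Prod>w\<leftarrow>ws. (fst w)\<^sup>2 - y\<^sup>2) * rowdet two_block_row ws"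
proof -
  let ?zs = "(y, a, b) # (y, a', b') # ws"
  let ?T = "\<lambda>d c. if d = c then 1 else if c = d + 2 then - (y\<^sup>2) else 0"
  let ?\<phi> = "\<lambda>z c. if c < 2 then two_block_row z c
     else ((fst z)\<^sup>2 - y\<^sup>2) * two_block_row z (c - 2)"
  have "rowdet ?\<phi> ?zs = rowdet two_block_row ?zs * (\<Prod>c<length ?zs. ?T c c)"
  proof (rule rowdet_upper_columns[where T = ?T])
    fix z c assume c: "c < length ?zs"
    have "(\<Sum>d<length ?zs. two_block_row z d * ?T d c) =
          (\<Sum>d\<in>{d. d = c \<or> c = d + 2}. two_block_row z d * ?T d c)"
      using c by (intro sum.mono_neutral_right) auto
    also have "{d. d = c \<or> c = d + 2} = (if c < 2 then {c} else {c - 2, c})"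
      by auto
    finally have "(\<Sum>d<length ?zs. two_block_row z d * ?T d c) =
       (if c < 2 then two_block_row z c else two_block_row z c - y\<^sup>2 * two_block_row z (c - 2))"
      by (auto simp: algebra_simps)
    moreover have "two_block_row z c = (fst z)\<^sup>2 * two_block_row z (c - 2)" if "2 \<le> c"
    proof -
      from that obtain e where "c = e + 2" by (metis le_add_diff_inverse2)
      then show ?thesis
        by (cases z) (simp add: two_block_row_def power_add power_mult power2_eq_square)
    qed
    ultimately show "?\<phi> z c = (\<Sum>d<length ?zs. two_block_row z d * ?T d c)"
      by (simp add: algebra_simps)
  qed auto
  then have "rowdet two_block_row ?zs = rowdet ?\<phi> ([(y, a, b), (y, a', b')] @ ws)"
    by simp
  also have "\<dots> = rowdet ?\<phi> [(y, a, b), (y, a', b')] *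
      rowdet (\<lambda>z c. ?\<phi> z (length [(y, a, b), (y, a', b')] + c)) ws"
    by (rule rowdet_block_triangular) auto
  also have "rowdet ?\<phi> [(y, a, b), (y, a', b')] = a * b' - a' * b"
    by (simp add: rowdet_pair two_block_row_def)
  also have "rowdet (\<lambda>z c. ?\<phi> z (length [(y, a, b), (y, a', b')] + c)) ws =
      (\<Prod>w\<leftarrow>ws. (fst w)\<^sup>2 - y\<^sup>2) * rowdet two_block_row ws"
    by (rule rowdet_scale_rows) auto
  finally show ?thesis by (simp add: mult_ac)
qed

definition minor2 :: "'a \<times> 'a \<times> 'a \<Rightarrow> 'a \<times> 'a \<times> 'a \<Rightarrow> 'a :: comm_ring_1" where
  "minor2 y z = fst (snd y) * snd (snd z) - fst (snd z) * snd (snd y)"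

text \<open>
  Both sides are polynomials in the first entry of \<open>z\<close>. At minus the first entry of a row \<open>zs ! l\<close> the
  determinant is known from \<open>two_block_det_equal_x\<close>, as the rows only contain squares of the first
  entries.
\<close>

lemma two_block_det_expansion_distinct:
  fixes z :: "'a :: idom \<times> 'a \<times> 'a"
  assumes even: "even (length (z # zs))" and dist: "distinct (map fst zs)"
  shows "rowdet two_block_row (z # zs) =
    (\<Sum>k<length zs. (-1) ^ k * minor2 z (zs ! k) *
       (\<Prod>w\<leftarrow>drop_nth k zs. (fst z + fst w) * (fst (zs ! k) + fst w)) *
       rowdet two_block_row (drop_nth k zs))"
proof -
  obtain x a b where z: "z = (x, a, b)" by (cases z)
  let ?X = "\<lambda>k. fst (zs ! k)"
  define d where "d = length zs - 1"
  have len: "length zs = Suc d" and d: "even d"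
    using even by (cases zs; simp add: d_def)+
  obtain C where C: "\<And>z. rowdet two_block_row (z # zs) =
      (\<Sum>c<Suc (length zs). two_block_row z c * C c)"
    using rowdet_linear_in_first_row[of two_block_row zs] by blast
  define P where
    "P = (\<Sum>c<Suc (length zs). monom ((if even c then a else b) * C c) (2 * (c div 2)))"
  have poly_P: "poly P t = rowdet two_block_row ((t, a, b) # zs)" for t
    unfolding C by (simp add: P_def poly_sum poly_monom two_block_row_def mult_ac)
  have "degree P \<le> d"
    unfolding P_def
  proof (rule degree_sum_le)
    fix c assume "c \<in> {..<Suc (length zs)}"
    then have "2 * (c div 2) \<le> d"
      using len d by (auto elim!: evenE)
    then show "degree (monom ((if even c then a else b) * C c) (2 * (c div 2))) \<le> d"
      using degree_monom_le order_trans by blast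
  qed simp
  define q where "q k = (-1) ^ k * minor2 z (zs ! k) *
      (\<Prod>w\<leftarrow>drop_nth k zs. ?X k + fst w) * rowdet two_block_row (drop_nth k zs)" for k
  define R where "R = (\<Sum>k<length zs. smult (q k) (\<Prod>w\<leftarrow>drop_nth k zs. [:fst w, 1:]))"
  have poly_prod: "poly (\<Prod>w\<leftarrow>ws. [:fst w, 1:]) t = (\<Prod>w\<leftarrow>ws. t + fst w)"
    for ws :: "('a \<times> 'a \<times> 'a) list" and t
    by (induction ws) (auto simp: algebra_simps)
  have poly_R: "poly R t = (\<Sum>k<length zs. q k * (\<Prod>w\<leftarrow>drop_nth k zs. t + fst w))" for t
    by (simp add: R_def poly_sum poly_prod)
  have degree_prod: "degree (\<Prod>w\<leftarrow>ws. [:fst w, 1:]) \<le> length ws"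
    for ws :: "('a \<times> 'a \<times> 'a) list"
    by (induction ws) (auto simp del: mult_pCons_left intro!: order_trans[OF degree_mult_le])
  have "degree R \<le> d"
    unfolding R_def
    by (rule degree_sum_le)
       (use len in \<open>auto intro!: order_trans[OF degree_smult_le] order_trans[OF degree_prod]\<close>)
  \<comment> \<open>The degrees are at most \<open>d\<close>, so \<open>d + 1\<close> nodes suffice. At the node with index \<open>l\<close> only the
    summand \<open>l\<close> of \<open>R\<close> survives.\<close>
  have node: "poly P (- ?X l) = poly R (- ?X l)" if l: "l < length zs" for l
  proof -
    have "poly P (- ?X l) = rowdet two_block_row ((?X l, a, b) # zs)"
      unfolding poly_P C by (simp add: two_block_row_def power_mult)
    also have "\<dots> = (-1) ^ l * rowdet two_block_row ((?X l, a, b) # zs ! l # drop_nth l zs)"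
      using rowdet_move_row[OF l, of two_block_row "[(?X l, a, b)]"]
      by (simp flip: power_add mult.assoc add: mult_2[symmetric])
    also have "\<dots> = (-1) ^ l * (minor2 z (zs ! l) *
        (\<Prod>w\<leftarrow>drop_nth l zs. (fst w)\<^sup>2 - (?X l)\<^sup>2) * rowdet two_block_row (drop_nth l zs))"
      using two_block_det_equal_x[of "?X l" a b "fst (snd (zs ! l))" "snd (snd (zs ! l))"]
      by (simp add: minor2_def z)
    also have "(\<Prod>w\<leftarrow>drop_nth l zs. (fst w)\<^sup>2 - (?X l)\<^sup>2) =
       (\<Prod>w\<leftarrow>drop_nth l zs. ?X l + fst w) * (\<Prod>w\<leftarrow>drop_nth l zs. - ?X l + fst w)"
      by (simp add: prod_list_map_nth flip: prod.distrib)
         (simp add: algebra_simps power2_eq_square)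
    finally have "poly P (- ?X l) = q l * (\<Prod>w\<leftarrow>drop_nth l zs. - ?X l + fst w)"
      by (simp add: q_def mult_ac)
    also have "\<dots> = poly R (- ?X l)"
      unfolding poly_R
    proof (subst sum.remove[of _ l])
      have "(\<Prod>w\<leftarrow>drop_nth k zs. - ?X l + fst w) = 0" if "k \<in> {..<length zs} - {l}" for k
        using that l nth_in_drop_nth[of l zs k] by (auto simp: prod_list_zero_iff image_iff
            intro!: bexI[of _ "zs ! l"])
      then have "(\<Sum>k\<in>{..<length zs} - {l}. q k * (\<Prod>w\<leftarrow>drop_nth k zs. - ?X l + fst w)) = 0"
        by (intro sum.neutral ballI) (simp only: mult_zero_right)
      then show "q l * (\<Prod>w\<leftarrow>drop_nth l zs. - ?X l + fst w) =
         q l * (\<Prod>w\<leftarrow>drop_nth l zs. - ?X l + fst w) +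
         (\<Sum>k\<in>{..<length zs} - {l}. q k * (\<Prod>w\<leftarrow>drop_nth k zs. - ?X l + fst w))"
        by (simp only: add_0_right)
    qed (use l in auto)
    finally show ?thesis .
  qed
  have "card ((\<lambda>l. - ?X l) ` {..<length zs}) = Suc d"
    using dist by (subst card_image) (auto simp: inj_on_def len distinct_conv_nth)
  then have "P = R"
    using node \<open>degree P \<le> d\<close> \<open>degree R \<le> d\<close>
    by (intro poly_eqI_degree[where A = "(\<lambda>l. - ?X l) ` {..<length zs}"]) auto
  then have "rowdet two_block_row (z # zs) = poly R x"
    using poly_P[of x] by (simp add: z)
  also have "\<dots> = (\<Sum>k<length zs. (-1) ^ k * minor2 z (zs ! k) *
       (\<Prod>w\<leftarrow>drop_nth k zs. (fst z + fst w) * (fst (zs ! k) + fst w)) *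
       rowdet two_block_row (drop_nth k zs))"
    unfolding poly_R q_def
    by (rule sum.cong) (auto simp: z prod_list_map_nth prod.distrib mult_ac)
  finally show ?thesis .
qed

text \<open>
  Distinctness of the first entries is removed by perturbing them to \<open>x\<^sub>i + t\<^bsup>i+1\<^esup>\<close>, which are
  distinct polynomials in \<open>t\<close>, and putting \<open>t = 0\<close> in the resulting identity.
\<close>

lemma two_block_det_expansion:
  fixes z :: "'a :: idom \<times> 'a \<times> 'a"
  assumes even: "even (length (z # zs))"
  shows "rowdet two_block_row (z # zs) =
    (\<Sum>k<length zs. (-1) ^ k * minor2 z (zs ! k) *
       (\<Prod>w\<leftarrow>drop_nth k zs. (fst z + fst w) * (fst (zs ! k) + fst w)) *
       rowdet two_block_row (drop_nth k zs))"
proof -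
  interpret at_0: comm_ring_hom "\<lambda>p :: 'a poly. poly p 0"
    by unfold_locales auto
  define red :: "'a poly \<times> 'a poly \<times> 'a poly \<Rightarrow> 'a \<times> 'a \<times> 'a"
    where "red = (\<lambda>(p, q, r). (poly p 0, poly q 0, poly r 0))"
  define lift :: "nat \<Rightarrow> 'a \<times> 'a \<times> 'a \<Rightarrow> 'a poly \<times> 'a poly \<times> 'a poly"
    where "lift i = (\<lambda>(x, a, b). ([:x:] + monom 1 (Suc i), [:a:], [:b:]))" for i
  have red_lift: "red (lift i w) = w" for i w
    by (cases w) (simp add: red_def lift_def poly_monom)
  define z' where "z' = lift 0 z"
  define zs' where "zs' = map (\<lambda>i. lift (Suc i) (zs ! i)) [0..<length zs]"
  have z': "red z' = z" and zs': "map red zs' = zs"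
    by (auto simp: z'_def zs'_def red_lift comp_def map_nth)
  then have len: "length zs' = length zs"
    by (metis length_map)
  have nth: "red (zs' ! k) = zs ! k" if "k < length zs" for k
    using that by (metis len nth_map zs')
  have degree_lift: "degree (fst (lift i w)) = Suc i" for i w
    by (cases w) (simp add: lift_def degree_monom_eq degree_add_eq_right)
  have "distinct (map degree (map fst (z' # zs')))"
    by (auto simp: z'_def zs'_def degree_lift comp_def distinct_map inj_on_def)
  then have dist: "distinct (map fst (z' # zs'))"
    by (simp only: distinct_map)
  have red_row: "poly (two_block_row w c) 0 = two_block_row (red w) c" for w c
    by (cases w) (simp add: two_block_row_def red_def)
  have red_det: "poly (rowdet two_block_row ws) 0 = rowdet two_block_row (map red ws)" for ws
    by (simp add: at_0.hom_rowdet red_row rowdet_map)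
  have red_minor: "poly (minor2 u v) 0 = minor2 (red u) (red v)" for u v
    by (cases u; cases v) (simp add: minor2_def red_def)
  have red_fst: "poly (fst u) 0 = fst (red u)" for u
    by (cases u) (simp add: red_def)
  have red_prod: "poly (\<Prod>w\<leftarrow>ws. (fst u + fst w) * (fst v + fst w)) 0 =
      (\<Prod>w\<leftarrow>map red ws. (fst (red u) + fst w) * (fst (red v) + fst w))" for u v ws
    by (induction ws) (simp_all add: red_fst)
  have "rowdet two_block_row (z # zs) = poly (rowdet two_block_row (z' # zs')) 0"
    by (simp add: red_det z' zs')
  also have "\<dots> = (\<Sum>k<length zs'. (-1) ^ k * minor2 (red z') (red (zs' ! k)) *
       (\<Prod>w\<leftarrow>map red (drop_nth k zs'). (fst (red z') + fst w) * (fst (red (zs' ! k)) + fst w)) *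
       rowdet two_block_row (map red (drop_nth k zs')))"
    by (subst two_block_det_expansion_distinct)
       (use even dist in \<open>simp_all add: len poly_sum red_det red_minor red_prod\<close>)
  also have "\<dots> = (\<Sum>k<length zs. (-1) ^ k * minor2 z (zs ! k) *
       (\<Prod>w\<leftarrow>drop_nth k zs. (fst z + fst w) * (fst (zs ! k) + fst w)) *
       rowdet two_block_row (drop_nth k zs))"
    by (rule sum.cong) (simp_all add: len z' map_drop_nth zs' nth)
  finally show ?thesis .
qed

text \<open>
  Divided by the product of all \<open>x\<^sub>i + x\<^sub>j\<close>, the expansion above becomes the expansion of the Pfaffian
  along its first row: only the sum for the deleted pair of rows is left in the denominator.
\<close>

theorem two_block_det_eq_pfaffian:
  fixes zs :: "('a :: field \<times> 'a \<times> 'a) list"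
  assumes "even (length zs)" and "sorted_wrt (\<lambda>y z. fst y + fst z \<noteq> 0) zs"
  shows "rowdet two_block_row zs = pair_prod (\<lambda>y z. fst y + fst z) zs *
           pfaffian (\<lambda>y z. minor2 y z / (fst y + fst z)) zs"
  using assms
proof (induction "\<lambda>y z :: 'a \<times> 'a \<times> 'a. minor2 y z / (fst y + fst z)" zs rule: pfaffian.induct)
  case (2 z zs)
  let ?s = "\<lambda>y z :: 'a \<times> 'a \<times> 'a. fst y + fst z" and ?M = "\<lambda>y z :: 'a \<times> 'a \<times> 'a. minor2 y z / (fst y + fst z)"
  have "(-1) ^ k * minor2 z (zs ! k) * (\<Prod>w\<leftarrow>drop_nth k zs. ?s z w * ?s (zs ! k) w) *
          rowdet two_block_row (drop_nth k zs) =
        pair_prod ?s (z # zs) * ((-1) ^ k * ?M z (zs ! k) * pfaffian ?M (drop_nth k zs))"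
    if k: "k < length zs" for k
  proof -
    have IH: "rowdet two_block_row (drop_nth k zs) =
        pair_prod ?s (drop_nth k zs) * pfaffian ?M (drop_nth k zs)"
      using 2 k by (auto simp: sorted_wrt_drop_nth)
    have "(\<Prod>w\<leftarrow>zs. ?s z w) = ?s z (zs ! k) * (\<Prod>w\<leftarrow>drop_nth k zs. ?s z w)"
      using arg_cong[OF mset_drop_nth[OF k], of "\<lambda>S. prod_mset (image_mset (?s z) S)"]
      by (simp add: prod_mset_prod_list flip: mset_map)
    then have "pair_prod ?s (z # zs) = ?s z (zs ! k) * (\<Prod>w\<leftarrow>drop_nth k zs. ?s z w * ?s (zs ! k) w) *
        pair_prod ?s (drop_nth k zs)"
      using pair_prod_drop_nth[OF k, of ?s]
      by (simp add: add.commute mult_ac prod_list_map_nth prod.distrib)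
    moreover have "?s z (zs ! k) \<noteq> 0"
      using "2.prems"(2) k by simp
    ultimately show ?thesis
      by (simp add: IH)
  qed
  then show ?case
    by (simp only: two_block_det_expansion[OF "2.prems"(1)] pfaffian.simps sum_distrib_left)
       (auto intro!: sum.cong)
qed simp

lemma pair_prod_nonzero:
  fixes f :: "'b \<Rightarrow> 'b \<Rightarrow> 'a :: idom"
  assumes "sorted_wrt (\<lambda>y z. f y z \<noteq> 0) zs"
  shows "pair_prod f zs \<noteq> 0"
  using assms by (induction zs) (auto simp: prod_list_zero_iff)

text \<open>
  Schur's Pfaffian. For the rows \<open>(y, 1, y)\<close> the two-block determinant is Vandermonde's.
\<close>

corollary schur_pfaffian:
  fixes ys :: "'a :: field list"
  assumes "even (length ys)" and "sorted_wrt (\<lambda>y z. y + z \<noteq> 0) ys"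
  shows "pair_prod (\<lambda>y z. (z - y) / (z + y)) ys = pfaffian (\<lambda>y z. (z - y) / (z + y)) ys"
proof -
  let ?r = "\<lambda>y :: 'a. (y, 1, y)" and ?K = "\<lambda>y z :: 'a. (z - y) / (z + y)"
  have row: "two_block_row (?r y) = (\<lambda>c. y ^ c)" for y
    by (rule ext) (auto simp: two_block_row_def elim!: evenE oddE)
  have "pair_prod (\<lambda>y z. z - y) ys = rowdet two_block_row (map ?r ys)"
    by (simp add: rowdet_map row rowdet_Vandermonde)
  also have "\<dots> = pair_prod (\<lambda>y z. y + z) ys * pfaffian ?K ys"
    using assms
    by (subst two_block_det_eq_pfaffian)
       (auto simp: sorted_wrt_map pair_prod_map pfaffian_map minor2_def add.commute)
  finally have "pair_prod (\<lambda>y z. y + z) ys * pfaffian ?K ys = pair_prod (\<lambda>y z. z - y) ys" ..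
  also have "\<dots> = pair_prod (\<lambda>y z. (y + z) * ?K y z) ys"
    by (rule pair_prod_cong, rule sorted_wrt_mono_rel[OF _ assms(2)]) (auto simp: field_simps)
  also have "\<dots> = pair_prod (\<lambda>y z. y + z) ys * pair_prod ?K ys"
    by (rule pair_prod_mult)
  finally show ?thesis
    using pair_prod_nonzero[OF assms(2)] by simp
qed

section \<open>Sums over tuples of points\<close>

text \<open>
  The sum of \<open>w\<^sub>1(k\<^sub>1) \<cdots> w\<^sub>m(k\<^sub>m) G(k\<^sub>1, \<dots>, k\<^sub>m)\<close> over all tuples of points of \<open>I\<close>. Only its
  multilinearity in the weights matters, hence the recursion.
\<close>

fun weighted_sum :: "'i set \<Rightarrow> ('i \<Rightarrow> 'a :: comm_ring_1) list \<Rightarrow> ('i list \<Rightarrow> 'a) \<Rightarrow> 'a" where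
  "weighted_sum I [] G = G []"
| "weighted_sum I (w # ws) G = (\<Sum>k\<in>I. w k * weighted_sum I ws (\<lambda>s. G (k # s)))"

lemma weighted_sum_cong:
  assumes "\<And>s. length s = length ws \<Longrightarrow> set s \<subseteq> I \<Longrightarrow> G s = H s"
  shows "weighted_sum I ws G = weighted_sum I ws H"
  using assms
proof (induction ws arbitrary: G H)
  case (Cons w ws)
  have "weighted_sum I ws (\<lambda>s. G (k # s)) = weighted_sum I ws (\<lambda>s. H (k # s))" if "k \<in> I" for k
    using that by (intro Cons.IH Cons.prems) auto
  then show ?case by simp
qed auto

lemma weighted_sum_sum:
  "weighted_sum I ws (\<lambda>s. \<Sum>i\<in>A. G i s) = (\<Sum>i\<in>A. weighted_sum I ws (G i))"
proof (induction ws arbitrary: G)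
  case (Cons w ws)
  show ?case
    by (simp add: Cons.IH sum_distrib_left) (rule sum.swap)
qed simp

lemma weighted_sum_scale: "weighted_sum I ws (\<lambda>s. c * G s) = c * weighted_sum I ws G"
  by (induction ws arbitrary: G) (simp_all add: sum_distrib_left mult_ac)

text \<open>
  The weights may be summed in any order; here the one at position \<open>j\<close> comes first.
\<close>

lemma weighted_sum_pull:
  assumes "j < length ws"
  shows "weighted_sum I ws G =
    (\<Sum>l\<in>I. (ws ! j) l * weighted_sum I (drop_nth j ws) (\<lambda>s. G (take j s @ l # drop j s)))"
  using assms
proof (induction ws arbitrary: j G)
  case (Cons w ws)
  show ?case
  proof (cases j)
    case (Suc i)
    with Cons.prems have i: "i < length ws" by simp
    have "weighted_sum I (w # ws) G = (\<Sum>k\<in>I. w k * (\<Sum>l\<in>I. (ws ! i) l *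
        weighted_sum I (drop_nth i ws) (\<lambda>s. G (k # take i s @ l # drop i s))))"
      by (simp only: weighted_sum.simps Cons.IH[OF i])
    also have "\<dots> = (\<Sum>l\<in>I. \<Sum>k\<in>I. w k * ((ws ! i) l *
        weighted_sum I (drop_nth i ws) (\<lambda>s. G (k # take i s @ l # drop i s))))"
      by (simp only: sum_distrib_left) (rule sum.swap)
    finally show ?thesis
      by (simp add: Suc sum_distrib_left mult.left_commute)
  qed simp
qed simp

lemma weighted_sum_eq_sum_lists:
  assumes "finite I"
  shows "weighted_sum I ws G = (\<Sum>s | length s = length ws \<and> set s \<subseteq> I.
           (\<Prod>i<length ws. (ws ! i) (s ! i)) * G s)"
proof (induction ws arbitrary: G)
  case (Cons w ws)
  let ?L = "{s. length s = length ws \<and> set s \<subseteq> I}"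
  have "weighted_sum I (w # ws) G =
      (\<Sum>k\<in>I. \<Sum>s\<in>?L. w k * ((\<Prod>i<length ws. (ws ! i) (s ! i)) * G (k # s)))"
    by (simp add: Cons.IH sum_distrib_left)
  also have "\<dots> = (\<Sum>(k, s)\<in>I \<times> ?L. w k * ((\<Prod>i<length ws. (ws ! i) (s ! i)) * G (k # s)))"
    by (rule sum.cartesian_product)
  also have "\<dots> = (\<Sum>s | length s = length (w # ws) \<and> set s \<subseteq> I.
           (\<Prod>i<length (w # ws). ((w # ws) ! i) (s ! i)) * G s)"
    by (rule sum.reindex_bij_witness[of _ "\<lambda>s. (hd s, tl s)" "\<lambda>(k, s). k # s"])
      (auto simp: length_Suc_conv prod.lessThan_Suc_shift mult_ac simp del: prod.lessThan_Suc)
  finally show ?case .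
qed (simp cong: conj_cong)

text \<open>
  Averaging an expansion along a first row whose entries \<open>h\<close> depend on the column only. It serves both
  for a row of the averaged matrix and for the constant row of the additional point \<open>0\<close>.
\<close>

lemma weighted_sum_pfaffian_step:
  "weighted_sum I ws (\<lambda>s. \<Sum>j<length s. (-1) ^ j * h (s ! j) * pfaffian K (drop_nth j s)) =
   (\<Sum>j<length ws. (-1) ^ j * (\<Sum>l\<in>I. (ws ! j) l * h l) * weighted_sum I (drop_nth j ws) (pfaffian K))"
proof -
  have "weighted_sum I ws (\<lambda>s. \<Sum>j<length s. (-1) ^ j * h (s ! j) * pfaffian K (drop_nth j s)) =
      weighted_sum I ws (\<lambda>s. \<Sum>j<length ws. (-1) ^ j * h (s ! j) * pfaffian K (drop_nth j s))"
    by (rule weighted_sum_cong) simp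
  also have "\<dots> = (\<Sum>j<length ws. weighted_sum I ws (\<lambda>s. (-1) ^ j * h (s ! j) * pfaffian K (drop_nth j s)))"
    by (rule weighted_sum_sum)
  also have "\<dots> = (\<Sum>j<length ws. (-1) ^ j * (\<Sum>l\<in>I. (ws ! j) l * h l) *
      weighted_sum I (drop_nth j ws) (pfaffian K))"
  proof (rule sum.cong[OF refl])
    fix j assume "j \<in> {..<length ws}"
    then have j: "j < length ws" by simp
    have "weighted_sum I ws (\<lambda>s. (-1) ^ j * h (s ! j) * pfaffian K (drop_nth j s)) =
      (\<Sum>l\<in>I. (ws ! j) l * weighted_sum I (drop_nth j ws)
        (\<lambda>s. (-1) ^ j * h ((take j s @ l # drop j s) ! j) * pfaffian K (drop_nth j (take j s @ l # drop j s))))"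
      by (rule weighted_sum_pull[OF j])
    also have "\<dots> = (\<Sum>l\<in>I. (ws ! j) l * weighted_sum I (drop_nth j ws)
        (\<lambda>s. (-1) ^ j * h l * pfaffian K s))"
      by (intro sum.cong refl arg_cong2[of _ _ _ _ "(*)"] weighted_sum_cong)
        (use j in \<open>auto simp: drop_nth_def nth_append min_def\<close>)
    finally show "weighted_sum I ws (\<lambda>s. (-1) ^ j * h (s ! j) * pfaffian K (drop_nth j s)) =
      (-1) ^ j * (\<Sum>l\<in>I. (ws ! j) l * h l) * weighted_sum I (drop_nth j ws) (pfaffian K)"
      by (simp only: weighted_sum_scale) (simp add: sum_distrib_left sum_distrib_right mult_ac)
  qed
  finally show ?thesis .
qed

text \<open>A Pfaffian is multilinear, so it may be averaged entry by entry.\<close>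

lemma weighted_sum_pfaffian:
  "weighted_sum I ws (pfaffian K) = pfaffian (\<lambda>v w. \<Sum>k\<in>I. \<Sum>l\<in>I. v k * w l * K k l) ws"
proof (induction "\<lambda>v w. \<Sum>k\<in>I. \<Sum>l\<in>I. v k * w l * K k l" ws rule: pfaffian.induct)
  case (2 w ws)
  let ?M = "\<lambda>v w. \<Sum>k\<in>I. \<Sum>l\<in>I. v k * w l * K k l"
  have "weighted_sum I (w # ws) (pfaffian K) =
      (\<Sum>k\<in>I. w k * (\<Sum>j<length ws. (-1) ^ j * (\<Sum>l\<in>I. (ws ! j) l * K k l) *
        weighted_sum I (drop_nth j ws) (pfaffian K)))"
    by (simp add: weighted_sum_pfaffian_step)
  also have "\<dots> = (\<Sum>j<length ws. \<Sum>k\<in>I. w k * ((-1) ^ j * (\<Sum>l\<in>I. (ws ! j) l * K k l) *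
        weighted_sum I (drop_nth j ws) (pfaffian K)))"
    by (simp only: sum_distrib_left) (rule sum.swap)
  also have "\<dots> = (\<Sum>j<length ws. (-1) ^ j * ?M w (ws ! j) *
        weighted_sum I (drop_nth j ws) (pfaffian K))"
    by (intro sum.cong refl) (simp add: sum_distrib_left sum_distrib_right mult_ac)
  also have "\<dots> = pfaffian ?M (w # ws)"
    using 2 by simp
  finally show ?case .
qed simp

section \<open>Power sums weighted by partial fractions\<close>

definition generic_points :: "(nat \<Rightarrow> 'a :: field) \<Rightarrow> nat \<Rightarrow> bool" where
  "generic_points x n \<longleftrightarrow>
     inj_on x {1..n} \<and> (\<forall>i\<in>{1..n}. \<forall>j\<in>{1..n}. x i + x j \<noteq> 0)"

lemma generic_points_Suc: "generic_points x (Suc n) \<Longrightarrow> generic_points x n"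
  by (auto simp: generic_points_def inj_on_def)

text \<open>
  \<open>x\<^sub>k\<close> times this weight is the residue of \<open>\<Prod>\<^sub>j (z + x\<^sub>j) / (z - x\<^sub>j)\<close> at \<open>z = x\<^sub>k\<close>.
\<close>

definition weight :: "(nat \<Rightarrow> 'a :: field) \<Rightarrow> nat \<Rightarrow> nat \<Rightarrow> 'a" where
  "weight x n k = 2 * (\<Prod>j\<in>{1..n} - {k}. (x k + x j) / (x k - x j))"

lemma x_times_weight:
  assumes "generic_points x n" and "k \<in> {1..n}"
  shows "x k * weight x n k * (\<Prod>j\<in>{1..n} - {k}. x k - x j) = (\<Prod>j=1..n. x k + x j)"
proof -
  have "x k \<noteq> x j" if "j \<in> {1..n} - {k}" for j
    using assms that unfolding generic_points_def by (metis DiffE inj_onD singletonI)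
  then have "(\<Prod>j\<in>{1..n} - {k}. x k - x j) \<noteq> 0"
    by (simp add: prod_zero_iff)
  moreover have "(\<Prod>j=1..n. x k + x j) = (x k + x k) * (\<Prod>j\<in>{1..n} - {k}. x k + x j)"
    using assms by (subst prod.remove[of _ k]) auto
  ultimately show ?thesis
    by (simp add: weight_def prod_dividef field_simps)
qed

text \<open>
  The partial fraction expansion of \<open>\<Prod> (z + x\<^sub>j) / (z - x\<^sub>j)\<close>, cleared of denominators: both sides
  have degree less than \<open>n\<close> and agree at the \<open>n\<close> points \<open>x\<^sub>k\<close>.
\<close>

lemma partial_fractions:
  assumes gen: "generic_points x n"
  shows "(\<Prod>j=1..n. z + x j) - (\<Prod>j=1..n. z - x j) =
    (\<Sum>k=1..n. x k * weight x n k * (\<Prod>j\<in>{1..n} - {k}. z - x j))"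
proof -
  let ?lin = "\<lambda>c. [:c, 1:] :: 'a poly"
  have deg: "degree (\<Prod>j\<in>A. ?lin (f j)) = card A" for A :: "nat set" and f
    by (simp add: degree_prod_eq_sum_degree)
  have monic: "coeff (\<Prod>j\<in>A. ?lin (f j)) (card A) = 1" for A :: "nat set" and f
    using lead_coeff_prod[of "\<lambda>j. ?lin (f j)" A] by (simp add: deg)
  define P where "P = (\<Prod>j=1..n. ?lin (x j)) - (\<Prod>j=1..n. ?lin (- x j))"
  define R where "R = (\<Sum>k=1..n. smult (x k * weight x n k) (\<Prod>j\<in>{1..n} - {k}. ?lin (- x j)))"
  have "P = R"
  proof (rule poly_eqI_degree_lead_coeff[where A = "x ` {1..n}" and n = n])
    show "degree P \<le> n"
      unfolding P_def by (rule order_trans[OF degree_diff_le_max]) (simp add: deg)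
    have R: "degree R \<le> n - 1"
      unfolding R_def
      by (rule degree_sum_le) (auto intro!: order_trans[OF degree_smult_le] simp: deg)
    then show "degree R \<le> n" by simp
    have "coeff P n = 0"
      using monic[where A = "{1..n}"] by (simp add: P_def deg)
    moreover have "coeff R n = 0"
    proof (cases "n = 0")
      case False
      with R show ?thesis by (intro coeff_eq_0) linarith
    qed (simp add: R_def)
    ultimately show "coeff P n = coeff R n" by simp
    show "n \<le> card (x ` {1..n})"
      using gen by (simp add: generic_points_def card_image)
    fix t assume "t \<in> x ` {1..n}"
    then obtain k where k: "k \<in> {1..n}" "t = x k" by auto
    have "poly P t = (\<Prod>j=1..n. x k + x j)"
      using k by (simp add: P_def poly_prod add.commute) (auto simp: prod_zero_iff)
    also have "\<dots> = x k * weight x n k * (\<Prod>j\<in>{1..n} - {k}. x k - x j)"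
      using x_times_weight[OF gen k(1)] by simp
    also have "\<dots> = (\<Sum>i=1..n. x i * weight x n i * (\<Prod>j\<in>{1..n} - {i}. x k - x j))"
    proof (subst sum.remove[of _ k])
      have "(\<Prod>j\<in>{1..n} - {i}. x k - x j) = 0" if "i \<in> {1..n} - {k}" for i
        using that k by (auto simp: prod_zero_iff)
      then show "x k * weight x n k * (\<Prod>j\<in>{1..n} - {k}. x k - x j) =
        x k * weight x n k * (\<Prod>j\<in>{1..n} - {k}. x k - x j) +
        (\<Sum>i\<in>{1..n} - {k}. x i * weight x n i * (\<Prod>j\<in>{1..n} - {i}. x k - x j))"
        by (subst sum.neutral) auto
    qed (use k in auto)
    also have "\<dots> = poly R t"
      by (simp add: R_def poly_sum poly_prod k(2))
    finally show "poly P t = poly R t" .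
  qed
  then have "poly P z = poly R z" by simp
  then show ?thesis
    by (simp add: P_def R_def poly_sum poly_prod add.commute)
qed

text \<open>
  The partial fraction expansion at \<open>z = 0\<close>.
\<close>

lemma sum_weight:
  assumes gen: "generic_points x n"
  shows "(\<Sum>k=1..n. weight x n k) = 1 - (-1) ^ n"
proof -
  let ?p = "\<Prod>j=1..n. x j"
  have x: "x k \<noteq> 0" if "k \<in> {1..n}" for k
    using that gen unfolding generic_points_def by (metis add_0)
  have neg: "(\<Prod>j=1..n. - x j) = (-1) ^ n * ?p"
    by (simp add: prod_uminus)
  have "x k * weight x n k * (\<Prod>j\<in>{1..n} - {k}. 0 - x j) = weight x n k * - ((-1) ^ n * ?p)"
    if "k \<in> {1..n}" for k
  proof -
    have "(\<Prod>j=1..n. - x j) = - x k * (\<Prod>j\<in>{1..n} - {k}. - x j)"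
      using that by (subst prod.remove[of _ k]) auto
    then have "x k * (\<Prod>j\<in>{1..n} - {k}. 0 - x j) = - ((-1) ^ n * ?p)"
      using neg by (simp del: One_nat_def)
    then show ?thesis
      by (metis mult.assoc mult.commute)
  qed
  then have "?p - (-1) ^ n * ?p = (\<Sum>k=1..n. weight x n k) * - ((-1) ^ n * ?p)"
    using partial_fractions[OF gen, of 0] by (simp add: neg sum_distrib_right sum_negf del: One_nat_def)
  then have "?p * (1 - (-1) ^ n) = ?p * (- ((-1) ^ n) * (\<Sum>k=1..n. weight x n k))"
    by (simp add: algebra_simps)
  moreover have "?p \<noteq> 0" using x by (simp add: prod_zero_iff)
  ultimately have "1 - (-1) ^ n = - ((-1) ^ n) * (\<Sum>k=1..n. weight x n k)"
    by (metis mult_left_cancel)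
  then show ?thesis
    by (cases "even n") (auto simp: eq_neg_iff_add_eq_0)
qed

text \<open>
  At \<open>z = - x\<^sub>l\<close> the first product of the partial fraction expansion vanishes. This gives the sum of
  the \<open>x\<^sub>k w\<^sub>k / (x\<^sub>l + x\<^sub>k)\<close>, and the kernel is \<open>1 - 2 x\<^sub>k / (x\<^sub>l + x\<^sub>k)\<close>.
\<close>

lemma sum_weight_kernel:
  assumes gen: "generic_points x n" and l: "l \<in> {1..n}"
  shows "(\<Sum>k=1..n. weight x n k * ((x l - x k) / (x l + x k))) = - (1 + (-1) ^ n)"
proof -
  let ?p = "\<Prod>j=1..n. - x l - x j"
  have sum0: "x k + x j \<noteq> 0" if "k \<in> {1..n}" "j \<in> {1..n}" for k j
    using gen that by (simp add: generic_points_def)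
  have "- x l - x j \<noteq> 0" if "j \<in> {1..n}" for j
    using sum0[OF l that] by (metis add.inverse_neutral add.inverse_inverse minus_diff_eq
        diff_minus_eq_add add.commute)
  then have p: "?p \<noteq> 0"
    by (simp add: prod_zero_iff)
  have "(\<Prod>j\<in>{1..n} - {k}. - x l - x j) = - ?p / (x l + x k)" if k: "k \<in> {1..n}" for k
  proof -
    have "?p = (- x l - x k) * (\<Prod>j\<in>{1..n} - {k}. - x l - x j)"
      using k by (subst prod.remove[of _ k]) auto
    then have "(\<Prod>j\<in>{1..n} - {k}. - x l - x j) * (x l + x k) = - ?p"
      by (simp only:) (simp add: algebra_simps)
    then show ?thesis
      using sum0[OF l k] by (metis nonzero_eq_divide_eq)
  qed
  then have "(\<Sum>k=1..n. x k * weight x n k * (\<Prod>j\<in>{1..n} - {k}. - x l - x j)) =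
      (\<Sum>k=1..n. x k * weight x n k / (x l + x k)) * - ?p"
    by (simp add: sum_distrib_right sum_negf)
  moreover have "(\<Prod>j=1..n. - x l + x j) = 0"
    using l by (auto simp: prod_zero_iff)
  ultimately have "- ?p = (\<Sum>k=1..n. x k * weight x n k / (x l + x k)) * - ?p"
    using partial_fractions[OF gen, of "- x l"] by (simp only: diff_0)
  then have 1: "(\<Sum>k=1..n. x k * weight x n k / (x l + x k)) = 1"
    using p by (simp only: mult_cancel_right1 neg_equal_0_iff_equal simp_thms)
  have "weight x n k * ((x l - x k) / (x l + x k)) =
      weight x n k - 2 * (x k * weight x n k / (x l + x k))" if "k \<in> {1..n}" for k
  proof -
    have "x l - x k = (x l + x k) - 2 * x k" by simp
    then have "(x l - x k) / (x l + x k) = 1 - 2 * x k / (x l + x k)"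
      using sum0[OF l that] by (simp only: diff_divide_distrib) simp
    then show ?thesis by (simp only: right_diff_distrib) (simp add: mult_ac)
  qed
  then have "(\<Sum>k=1..n. weight x n k * ((x l - x k) / (x l + x k))) =
      (\<Sum>k=1..n. weight x n k) - 2 * (\<Sum>k=1..n. x k * weight x n k / (x l + x k))"
    by (simp add: sum_subtractf sum_distrib_left)
  then show ?thesis
    by (simp only: 1 sum_weight[OF gen]) simp
qed

text \<open>
  For \<open>r > 0\<close> this is the symmetric polynomial \<open>q\<^sub>r(x\<^sub>1, \<dots>, x\<^sub>n)\<close>. At \<open>r = 0\<close> it is the sum of the
  weights, which is \<open>0\<close> or \<open>2\<close> and so differs from the usual \<open>q\<^sub>0 = 1\<close>.
\<close>

fun schur_q :: "(nat \<Rightarrow> 'a :: comm_ring_1) \<Rightarrow> nat \<Rightarrow> nat \<Rightarrow> 'a" where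
  "schur_q x n 0 = 1 - (-1) ^ n"
| "schur_q x 0 (Suc r) = 0"
| "schur_q x (Suc n) (Suc r) =
     x (Suc n) * schur_q x (Suc n) r + schur_q x n (Suc r) + x (Suc n) * schur_q x n r"

text \<open>
  Multiplying by \<open>x\<^sub>k - x\<^bsub>n+1\<^esub>\<close> kills the last point and turns the weights for \<open>n + 1\<close> points into
  those for \<open>n\<close> points, up to the factor \<open>x\<^sub>k + x\<^bsub>n+1\<^esub>\<close>. This is the recursion of \<open>schur_q\<close>.
\<close>

lemma power_sum_weight:
  assumes "generic_points x n"
  shows "(\<Sum>k=1..n. weight x n k * x k ^ r) = schur_q x n r"
  using assms
proof (induction x n r rule: schur_q.induct)
  case (3 x n r)
  let ?y = "x (Suc n)"
  have eq: "weight x (Suc n) k * (x k - ?y) = weight x n k * (x k + ?y)" if "k \<in> {1..n}" for k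
  proof -
    have "{1..Suc n} - {k} = insert (Suc n) ({1..n} - {k})"
      using that by auto
    then have "weight x (Suc n) k = (x k + ?y) / (x k - ?y) * weight x n k"
      by (simp add: weight_def)
    moreover have "x k = ?y \<longleftrightarrow> k = Suc n"
      using that "3.prems"
      by (intro inj_on_eq_iff[of x "{1..Suc n}"]) (auto simp: generic_points_def)
    then have "x k - ?y \<noteq> 0"
      using that by auto
    ultimately show ?thesis by simp
  qed
  have "(\<Sum>k=1..Suc n. weight x (Suc n) k * x k ^ Suc r) -
        ?y * (\<Sum>k=1..Suc n. weight x (Suc n) k * x k ^ r) =
      (\<Sum>k=1..Suc n. weight x (Suc n) k * (x k - ?y) * x k ^ r)"
    by (simp only: sum_distrib_left sum_subtractf[symmetric])
       (simp add: algebra_simps)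
  also have "\<dots> = (\<Sum>k=1..n. weight x (Suc n) k * (x k - ?y) * x k ^ r)"
    by simp
  also have "\<dots> = (\<Sum>k=1..n. weight x n k * (x k + ?y) * x k ^ r)"
    by (intro sum.cong refl) (simp only: eq)
  also have "\<dots> = (\<Sum>k=1..n. weight x n k * x k ^ Suc r) + ?y * (\<Sum>k=1..n. weight x n k * x k ^ r)"
    by (simp add: sum_distrib_left sum.distrib algebra_simps)
  finally have "(\<Sum>k=1..Suc n. weight x (Suc n) k * x k ^ Suc r) =
      ?y * (\<Sum>k=1..Suc n. weight x (Suc n) k * x k ^ r) +
      (\<Sum>k=1..n. weight x n k * x k ^ Suc r) + ?y * (\<Sum>k=1..n. weight x n k * x k ^ r)"
    by (simp only: algebra_simps)
  also have "\<dots> = schur_q x (Suc n) (Suc r)"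
    using 3 generic_points_Suc[of x n] by (simp only: schur_q.simps)
  finally show ?case .
qed (simp_all add: sum_weight del: One_nat_def)

text \<open>
  For \<open>a > b > 0\<close> this is \<open>Q\<^bsub>(a, b)\<^esub>(x\<^sub>1, \<dots>, x\<^sub>n)\<close>.
\<close>

fun schur_q2 :: "(nat \<Rightarrow> 'a :: comm_ring_1) \<Rightarrow> nat \<Rightarrow> nat \<Rightarrow> nat \<Rightarrow> 'a" where
  "schur_q2 x n 0 b = - (1 + (-1) ^ n) * schur_q x n b"
| "schur_q2 x n (Suc a) b =
     schur_q x n a * schur_q x n (Suc b) - schur_q x n (Suc a) * schur_q x n b - schur_q2 x n a (Suc b)"

text \<open>
  The factor \<open>x\<^sub>k + x\<^sub>l\<close> cancels the denominator of the kernel. This gives the recursion in \<open>a\<close>.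
\<close>

lemma double_power_sum_weight:
  assumes gen: "generic_points x n"
  shows "(\<Sum>k=1..n. \<Sum>l=1..n. (weight x n k * x k ^ a) * (weight x n l * x l ^ b) *
           ((x l - x k) / (x l + x k))) = schur_q2 x n a b"
proof (induction a arbitrary: b)
  case 0
  have "(\<Sum>k=1..n. \<Sum>l=1..n. (weight x n k * x k ^ 0) * (weight x n l * x l ^ b) *
           ((x l - x k) / (x l + x k))) =
        (\<Sum>l=1..n. (weight x n l * x l ^ b) *
           (\<Sum>k=1..n. weight x n k * ((x l - x k) / (x l + x k))))"
    by (subst sum.swap) (simp add: sum_distrib_left mult_ac)
  also have "\<dots> = (\<Sum>l=1..n. (weight x n l * x l ^ b) * - (1 + (-1) ^ n))"
    by (intro sum.cong refl) (simp only: sum_weight_kernel[OF gen])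
  also have "\<dots> = schur_q2 x n 0 b"
    by (simp only: sum_distrib_right[symmetric] power_sum_weight[OF gen] schur_q2.simps)
       (simp add: algebra_simps)
  finally show ?case .
next
  case (Suc a)
  let ?w = "\<lambda>k r. weight x n k * x k ^ r" and ?K = "\<lambda>k l. (x l - x k) / (x l + x k)"
  have split: "?w k (Suc a) * ?w l b * ?K k l =
      ?w k a * ?w l (Suc b) - ?w k (Suc a) * ?w l b - ?w k a * ?w l (Suc b) * ?K k l"
    if "k \<in> {1..n}" "l \<in> {1..n}" for k l
  proof -
    have "x l + x k \<noteq> 0"
      using gen that by (simp add: generic_points_def)
    then have "(x k + x l) * ?K k l = x l - x k"
      by (simp add: add.commute)
    moreover have "?w k (Suc a) * ?w l b * d + ?w k a * ?w l (Suc b) * d =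
        ?w k a * ?w l b * ((x k + x l) * d)" for d
      by (simp add: algebra_simps)
    ultimately have "?w k (Suc a) * ?w l b * ?K k l + ?w k a * ?w l (Suc b) * ?K k l =
        ?w k a * ?w l b * (x l - x k)"
      by (simp only:)
    also have "\<dots> = ?w k a * ?w l (Suc b) - ?w k (Suc a) * ?w l b"
      by (simp add: algebra_simps)
    finally show ?thesis
      by (simp only: eq_diff_eq)
  qed
  have "(\<Sum>k=1..n. \<Sum>l=1..n. ?w k (Suc a) * ?w l b * ?K k l) =
      (\<Sum>k=1..n. ?w k a) * (\<Sum>l=1..n. ?w l (Suc b)) -
      (\<Sum>k=1..n. ?w k (Suc a)) * (\<Sum>l=1..n. ?w l b) -
      (\<Sum>k=1..n. \<Sum>l=1..n. ?w k a * ?w l (Suc b) * ?K k l)"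
    unfolding sum_product sum_subtractf[symmetric]
    by (intro sum.cong refl) (rule split)
  also have "\<dots> = schur_q2 x n (Suc a) b"
    by (simp only: Suc.IH power_sum_weight[OF gen] schur_q2.simps)
  finally show ?case .
qed

section \<open>The Schur \<open>Q\<close>-function as a Pfaffian\<close>

lemma pair_prod_upt:
  "pair_prod f (map g [1..<Suc m]) = (\<Prod>i=1..m. \<Prod>j\<in>{i<..m}. f (g i) (g j))"
proof -
  have "pair_prod f (map g [a..<Suc m]) = (\<Prod>i=a..m. \<Prod>j\<in>{i<..m}. f (g i) (g j))" if "a \<le> Suc m" for a
    using that
  proof (induction rule: inc_induct)
    case (step a)
    have "(\<Prod>w\<leftarrow>map g [Suc a..<Suc m]. f (g a) w) = (\<Prod>j\<in>{a<..m}. f (g a) (g j))"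
      by (simp add: prod.distinct_set_conv_list[symmetric] comp_def atLeastLessThanSuc_atLeastAtMost
          atLeastSucAtMost_greaterThanAtMost del: upt_Suc)
    moreover have "{a..m} = insert a {Suc a..m}"
      using step.hyps by auto
    ultimately show ?case
      using step by (simp add: upt_conv_Cons del: upt_Suc)
  qed simp
  then show ?thesis by simp
qed

text \<open>
  Every factor of the definition occurs in the weights of the points \<open>\<sigma>(1), \<dots>, \<sigma>(m)\<close>. What the
  weights contain in addition, the factors with \<open>j < i \<le> m\<close>, is cancelled by the kernels.
\<close>

lemma Q_summand_eq_weights:
  assumes gen: "generic_points x n" and "m \<le> n" and \<sigma>: "\<sigma> permutes {1..n}"
  shows "2 ^ m * Q_summand m n lam (\<lambda>i. x (\<sigma> i)) =
    (\<Prod>i=1..m. weight x n (\<sigma> i) * x (\<sigma> i) ^ lam i) *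
    pair_prod (\<lambda>y z. (z - y) / (z + y)) (map (\<lambda>i. x (\<sigma> i)) [1..<Suc m])"
proof -
  define y where "y i = x (\<sigma> i)" for i
  let ?R = "\<lambda>i j. (y i + y j) / (y i - y j)" and ?K = "\<lambda>i j. (y j - y i) / (y j + y i)"
  have img: "\<sigma> i \<in> {1..n}" if "i \<in> {1..n}" for i
    using permutes_in_image[OF \<sigma>] that by blast
  have weight: "weight x n (\<sigma> i) = 2 * ((\<Prod>j\<in>{i<..n}. ?R i j) * (\<Prod>j\<in>{1..<i}. ?R i j))"
    if i: "i \<in> {1..m}" for i
  proof -
    have "\<sigma> ` {1..n} = {1..n}" by (rule permutes_image[OF \<sigma>])
    then have "{1..n} - {\<sigma> i} = \<sigma> ` ({1..n} - {i})"
      using permutes_inj[OF \<sigma>] by (auto simp: inj_eq image_set_diff)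
    then have "weight x n (\<sigma> i) = 2 * (\<Prod>j\<in>{1..n} - {i}. ?R i j)"
      unfolding weight_def
      by (simp add: prod.reindex inj_on_subset[OF permutes_inj[OF \<sigma>]] y_def)
    also have "{1..n} - {i} = {i<..n} \<union> {1..<i}"
      using i \<open>m \<le> n\<close> by auto
    also have "(\<Prod>j\<in>{i<..n} \<union> {1..<i}. ?R i j) =
        (\<Prod>j\<in>{i<..n}. ?R i j) * (\<Prod>j\<in>{1..<i}. ?R i j)"
      by (rule prod.union_disjoint) auto
    finally show ?thesis .
  qed
  have cancel: "?R j i * ?K i j = 1" if "i \<in> {1..<j}" "j \<in> {1..m}" for i j
  proof -
    have ij: "i \<in> {1..n}" "j \<in> {1..n}" "i \<noteq> j"
      using that \<open>m \<le> n\<close> by auto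
    then have "\<sigma> i \<noteq> \<sigma> j"
      using permutes_inj[OF \<sigma>] by (simp add: inj_eq)
    then have "y i \<noteq> y j" and "y j + y i \<noteq> 0"
      using gen img[OF ij(1)] img[OF ij(2)] by (auto simp: generic_points_def y_def inj_on_eq_iff)
    then show ?thesis by simp
  qed
  have "(\<Prod>i=1..m. \<Prod>j\<in>{i<..m}. ?K i j) = (\<Prod>(i, j)\<in>(SIGMA i:{1..m}. {i<..m}). ?K i j)"
    by (rule prod.Sigma) auto
  also have "\<dots> = (\<Prod>(j, i)\<in>(SIGMA j:{1..m}. {1..<j}). ?K i j)"
    by (rule prod.reindex_bij_witness[of _ "\<lambda>(j, i). (i, j)" "\<lambda>(i, j). (j, i)"]) auto
  also have "\<dots> = (\<Prod>j=1..m. \<Prod>i\<in>{1..<j}. ?K i j)"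
    by (rule prod.Sigma[symmetric]) auto
  finally have "(\<Prod>i=1..m. \<Prod>j\<in>{i<..m}. ?K i j) = (\<Prod>j=1..m. \<Prod>i\<in>{1..<j}. ?K i j)" .
  then have "(\<Prod>j=1..m. \<Prod>i\<in>{1..<j}. ?R j i) * (\<Prod>i=1..m. \<Prod>j\<in>{i<..m}. ?K i j) =
      (\<Prod>j=1..m. \<Prod>i\<in>{1..<j}. ?R j i * ?K i j)"
    by (simp only: prod.distrib)
  also have "\<dots> = 1"
    using cancel by (intro prod.neutral ballI) blast
  finally have "2 ^ m * Q_summand m n lam y =
      (2 ^ m * (\<Prod>i=1..m. y i ^ lam i) * (\<Prod>i=1..m. \<Prod>j\<in>{i<..n}. ?R i j)) *
      ((\<Prod>j=1..m. \<Prod>i\<in>{1..<j}. ?R j i) * (\<Prod>i=1..m. \<Prod>j\<in>{i<..m}. ?K i j))"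
    by (simp add: Q_summand_def)
  also have "\<dots> = (\<Prod>i=1..m. weight x n (\<sigma> i) * y i ^ lam i) * (\<Prod>i=1..m. \<Prod>j\<in>{i<..m}. ?K i j)"
  proof -
    have "(\<Prod>i=1..m. weight x n (\<sigma> i)) =
        2 ^ m * ((\<Prod>i=1..m. \<Prod>j\<in>{i<..n}. ?R i j) * (\<Prod>i=1..m. \<Prod>j\<in>{1..<i}. ?R i j))"
      using weight by (simp add: prod.distrib del: One_nat_def)
    then show ?thesis by (simp only: prod.distrib mult_ac)
  qed
  finally have "2 ^ m * Q_summand m n lam y =
      (\<Prod>i=1..m. weight x n (\<sigma> i) * y i ^ lam i) * (\<Prod>i=1..m. \<Prod>j\<in>{i<..m}. ?K i j)" .
  moreover have "y = (\<lambda>i. x (\<sigma> i))"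
    by (simp add: y_def fun_eq_iff)
  ultimately show ?thesis
    by (simp only: pair_prod_upt)
qed

text \<open>
  A left coset of the stabiliser is determined by the images of \<open>1, \<dots>, m\<close>, and every tuple of
  distinct points arises.
\<close>

lemma bij_betw_lcosets_tuples:
  assumes "m \<le> n"
  shows "bij_betw (\<lambda>C. map (SOME \<sigma>. \<sigma> \<in> C) [1..<Suc m])
    (lcosets\<^bsub>sym_group n\<^esub> (tail_perms m n)) {s. length s = m \<and> set s \<subseteq> {1..n} \<and> distinct s}"
    (is "bij_betw ?F ?C ?S")
proof -
  have C: "?C = (\<lambda>\<pi>. (\<lambda>\<rho>. \<pi> \<circ> \<rho>) ` tail_perms m n) ` {\<pi>. \<pi> permutes {1..n}}"
    by (auto simp: LCOSETS_def l_coset_def sym_group_def)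
  have rep: "\<exists>\<rho>. \<rho> permutes {m+1..n} \<and> (SOME \<sigma>. \<sigma> \<in> (\<lambda>\<rho>. \<pi> \<circ> \<rho>) ` tail_perms m n) = \<pi> \<circ> \<rho>" for \<pi>
  proof -
    have "(SOME \<sigma>. \<sigma> \<in> (\<lambda>\<rho>. \<pi> \<circ> \<rho>) ` tail_perms m n) \<in> (\<lambda>\<rho>. \<pi> \<circ> \<rho>) ` tail_perms m n"
      by (rule someI[of _ "\<pi> \<circ> id"]) (blast intro: permutes_id)
    then show ?thesis by auto
  qed
  have F: "?F ((\<lambda>\<rho>. \<pi> \<circ> \<rho>) ` tail_perms m n) = map \<pi> [1..<Suc m]" for \<pi>
  proof -
    obtain \<rho> where \<rho>: "\<rho> permutes {m+1..n}"
      and eq: "(SOME \<sigma>. \<sigma> \<in> (\<lambda>\<rho>. \<pi> \<circ> \<rho>) ` tail_perms m n) = \<pi> \<circ> \<rho>"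
      using rep by blast
    have "\<rho> i = i" if "i \<in> {1..m}" for i
      using that by (intro permutes_not_in[OF \<rho>]) auto
    then show ?thesis
      unfolding eq by (auto simp del: upt_Suc)
  qed
  have "inj_on ?F ?C"
  proof (rule inj_onI)
    fix A B assume "A \<in> ?C" "B \<in> ?C" and AB: "?F A = ?F B"
    then obtain \<pi> \<tau> where \<pi>: "\<pi> permutes {1..n}" and \<tau>: "\<tau> permutes {1..n}"
      and A: "A = (\<lambda>\<rho>. \<pi> \<circ> \<rho>) ` tail_perms m n" and B: "B = (\<lambda>\<rho>. \<tau> \<circ> \<rho>) ` tail_perms m n"
      unfolding C by auto
    have agree: "\<pi> i = \<tau> i" if "i \<in> {1..m}" for i
      using AB that unfolding A B F by (auto simp del: upt_Suc)
    define \<kappa> where "\<kappa> = inv_into UNIV \<pi> \<circ> \<tau>"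
    have "\<kappa> permutes {1..n}"
      unfolding \<kappa>_def using permutes_inv[OF \<pi>] \<tau> by (intro permutes_compose)
    moreover have "\<kappa> i = i" if "i \<in> {1..n} - {m+1..n}" for i
      using that agree[of i] by (auto simp: \<kappa>_def permutes_inverses(2)[OF \<pi>] simp flip: agree)
    ultimately have \<kappa>: "\<kappa> permutes {m+1..n}"
      by (rule permutes_superset)
    have \<tau>_eq: "\<tau> = \<pi> \<circ> \<kappa>"
      by (simp add: \<kappa>_def fun_eq_iff permutes_inverses(1)[OF \<pi>])
    show "A = B"
    proof
      show "B \<subseteq> A"
        unfolding A B \<tau>_eq using permutes_compose[OF _ \<kappa>] by (auto simp: comp_assoc)
      have "\<pi> \<circ> \<rho> = \<tau> \<circ> (inv_into UNIV \<kappa> \<circ> \<rho>)" for \<rho>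
        by (simp add: \<tau>_eq fun_eq_iff permutes_inverses(1)[OF \<kappa>])
      then show "A \<subseteq> B"
        unfolding A B using permutes_compose[OF _ permutes_inv[OF \<kappa>]] by auto
    qed
  qed
  moreover have "?F ` ?C = ?S"
  proof
    show "?F ` ?C \<subseteq> ?S"
    proof
      fix s assume "s \<in> ?F ` ?C"
      then obtain \<pi> where \<pi>: "\<pi> permutes {1..n}" and s: "s = map \<pi> [1..<Suc m]"
        unfolding C using F by auto
      have "\<pi> i \<in> {1..n}" if "i \<in> {1..m}" for i
        using that \<open>m \<le> n\<close> permutes_in_image[OF \<pi>, of i] by auto
      moreover have "distinct s"
        using permutes_inj[OF \<pi>] by (auto simp: s distinct_map intro: inj_on_subset simp del: upt_Suc)
      ultimately show "s \<in> ?S"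
        by (auto simp: s simp del: upt_Suc)
    qed
    show "?S \<subseteq> ?F ` ?C"
    proof
      fix s assume "s \<in> ?S"
      then have len: "length s = m" and set: "set s \<subseteq> {1..n}" and dist: "distinct s" by auto
      have "card {m+1..n} = card ({1..n} - set s)"
        using len set dist by (simp add: card_Diff_subset distinct_card)
      then obtain g where g: "bij_betw g {m+1..n} ({1..n} - set s)"
        using finite_same_card_bij[of "{m+1..n}" "{1..n} - set s"] by auto
      define \<pi> where "\<pi> i = (if i \<in> {1..m} then s ! (i - 1) else if i \<in> {m+1..n} then g i else i)" for i
      have "bij_betw (\<lambda>i. s ! (i - 1)) {1..m} (set s)"
      proof -
        have "bij_betw (\<lambda>i. i - 1) {1..m} {..<m}"
          by (rule bij_betw_byWitness[of _ Suc]) auto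
        from bij_betw_trans[OF this bij_betw_nth[OF dist _ refl]] len show ?thesis
          by (simp add: comp_def)
      qed
      then have "bij_betw \<pi> {1..m} (set s)"
        by (rule bij_betw_cong[THEN iffD1, rotated]) (auto simp: \<pi>_def)
      moreover have "bij_betw \<pi> {m+1..n} ({1..n} - set s)"
        by (rule bij_betw_cong[THEN iffD1, OF _ g]) (auto simp: \<pi>_def)
      ultimately have "bij_betw \<pi> ({1..m} \<union> {m+1..n}) (set s \<union> ({1..n} - set s))"
        by (rule bij_betw_combine) auto
      moreover have "{1..m} \<union> {m+1..n} = {1..n}" "set s \<union> ({1..n} - set s) = {1..n}"
        using \<open>m \<le> n\<close> set by auto
      ultimately have "\<pi> permutes {1..n}"
        using \<open>m \<le> n\<close> by (intro bij_imp_permutes) (auto simp: \<pi>_def)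
      then have "(\<lambda>\<rho>. \<pi> \<circ> \<rho>) ` tail_perms m n \<in> ?C"
        unfolding C by blast
      moreover have "s = ?F ((\<lambda>\<rho>. \<pi> \<circ> \<rho>) ` tail_perms m n)"
        unfolding F by (rule nth_equalityI) (auto simp: len \<pi>_def simp del: upt_Suc)
      ultimately show "s \<in> ?F ` ?C"
        by (rule rev_image_eqI)
    qed
  qed
  ultimately show ?thesis
    by (simp add: bij_betw_def)
qed

lemma pair_prod_zero_not_distinct:
  fixes f :: "'b \<Rightarrow> 'b \<Rightarrow> 'a :: idom"
  assumes "\<not> distinct s" and "\<And>y. f y y = 0"
  shows "pair_prod f s = 0"
  using assms by (induction s) (auto simp: prod_list_zero_iff intro!: image_eqI)

lemma lcoset_representative_permutes:
  assumes "C \<in> lcosets\<^bsub>sym_group n\<^esub> (tail_perms m n)"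
  shows "(SOME \<sigma>. \<sigma> \<in> C) permutes {1..n}"
proof -
  obtain \<pi> where \<pi>: "\<pi> permutes {1..n}" and C: "C = (\<lambda>\<rho>. \<pi> \<circ> \<rho>) ` tail_perms m n"
    using assms by (auto simp: LCOSETS_def l_coset_def sym_group_def)
  have "\<sigma> permutes {1..n}" if "\<sigma> \<in> C" for \<sigma>
  proof -
    from that obtain \<rho> where \<rho>: "\<rho> permutes {m+1..n}" and \<sigma>: "\<sigma> = \<pi> \<circ> \<rho>"
      unfolding C by blast
    have "\<rho> permutes {1..n}"
      by (rule permutes_subset[OF \<rho>]) auto
    then show ?thesis
      unfolding \<sigma> using \<pi> by (rule permutes_compose)
  qed
  moreover have "\<pi> \<circ> id \<in> C"
    unfolding C by (blast intro: permutes_id)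
  ultimately show ?thesis
    using someI[of "\<lambda>\<sigma>. \<sigma> \<in> C"] by blast
qed

text \<open>
  Extending the sum from injective to all tuples of points is possible because the kernel vanishes
  on the diagonal. Only the extended sum is multilinear in the weights.
\<close>

lemma coset_sum_eq_weighted_sum:
  assumes gen: "generic_points x n" and "m \<le> n"
  shows "2 ^ m * (\<Sum>C\<in>lcosets\<^bsub>sym_group n\<^esub> (tail_perms m n).
            Q_summand m n lam (\<lambda>i. x ((SOME \<sigma>. \<sigma> \<in> C) i))) =
    weighted_sum {1..n} (map (\<lambda>i k. weight x n k * x k ^ lam i) [1..<Suc m])
      (\<lambda>s. pair_prod (\<lambda>y z. (z - y) / (z + y)) (map x s))"
proof -
  let ?ws = "map (\<lambda>i k. weight x n k * x k ^ lam i) [1..<Suc m]"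
  let ?P = "pair_prod (\<lambda>y z. (z - y) / (z + y)) :: 'a list \<Rightarrow> 'a"
  let ?T = "\<lambda>s. (\<Prod>i<m. (?ws ! i) (s ! i)) * ?P (map x s)"
  let ?S = "{s. length s = m \<and> set s \<subseteq> {1..n} \<and> distinct s}"
  have "weighted_sum {1..n} ?ws (\<lambda>s. ?P (map x s)) = (\<Sum>s | length s = m \<and> set s \<subseteq> {1..n}. ?T s)"
    by (simp add: weighted_sum_eq_sum_lists del: upt_Suc One_nat_def)
  also have "\<dots> = (\<Sum>s\<in>?S. ?T s)"
  proof (rule sum.mono_neutral_right)
    show "finite {s. length s = m \<and> set s \<subseteq> {1..n}}"
      using finite_lists_length_eq[of "{1..n}" m] by (simp add: conj_commute)
    show "\<forall>s\<in>{s. length s = m \<and> set s \<subseteq> {1..n}} - ?S. ?T s = 0"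
    proof
      fix s assume "s \<in> {s. length s = m \<and> set s \<subseteq> {1..n}} - ?S"
      then have "\<not> distinct (map x s)"
        by (auto simp: distinct_map)
      then have "?P (map x s) = 0"
        by (rule pair_prod_zero_not_distinct) simp
      then show "?T s = 0" by simp
    qed
  qed auto
  also have "\<dots> = (\<Sum>C\<in>lcosets\<^bsub>sym_group n\<^esub> (tail_perms m n). ?T (map (SOME \<sigma>. \<sigma> \<in> C) [1..<Suc m]))"
    by (rule sum.reindex_bij_betw[OF bij_betw_lcosets_tuples[OF \<open>m \<le> n\<close>], symmetric])
  also have "\<dots> = (\<Sum>C\<in>lcosets\<^bsub>sym_group n\<^esub> (tail_perms m n).
      2 ^ m * Q_summand m n lam (\<lambda>i. x ((SOME \<sigma>. \<sigma> \<in> C) i)))"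
  proof (rule sum.cong[OF refl])
    fix C assume "C \<in> lcosets\<^bsub>sym_group n\<^esub> (tail_perms m n)"
    from lcoset_representative_permutes[OF this]
    have \<sigma>: "(SOME \<sigma>. \<sigma> \<in> C) permutes {1..n}" .
    show "?T (map (SOME \<sigma>. \<sigma> \<in> C) [1..<Suc m]) =
        2 ^ m * Q_summand m n lam (\<lambda>i. x ((SOME \<sigma>. \<sigma> \<in> C) i))"
      unfolding Q_summand_eq_weights[OF gen \<open>m \<le> n\<close> \<sigma>]
      by (simp add: prod.atLeast1_atMost_eq comp_def del: upt_Suc)
  qed
  finally show ?thesis
    by (simp only: sum_distrib_left)
qed

text \<open>
  Schur's Pfaffian needs an even number of points. For an odd number the point \<open>0\<close>, at which the
  kernel is \<open>1\<close>, is put in front; it is indexed by \<open>None\<close>.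
\<close>

fun Q_entry :: "(nat \<Rightarrow> 'a :: comm_ring_1) \<Rightarrow> nat \<Rightarrow> nat option \<Rightarrow> nat option \<Rightarrow> 'a" where
  "Q_entry x n (Some a) (Some b) = schur_q2 x n a b"
| "Q_entry x n None (Some b) = schur_q x n b"
| "Q_entry x n _ None = 0"

definition pad_even :: "'b list \<Rightarrow> 'b option list" where
  "pad_even rs = (if even (length rs) then map Some rs else None # map Some rs)"

text \<open>
  After Schur's identity the sum over tuples acts on each entry of the Pfaffian separately, and these
  sums have been computed.
\<close>

theorem coset_sum_eq_pfaffian:
  assumes gen: "generic_points x n" and "m \<le> n"
  shows "2 ^ m * (\<Sum>C\<in>lcosets\<^bsub>sym_group n\<^esub> (tail_perms m n).
            Q_summand m n lam (\<lambda>i. x ((SOME \<sigma>. \<sigma> \<in> C) i))) =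
    pfaffian (Q_entry x n) (pad_even (map lam [1..<Suc m]))"
proof -
  let ?rs = "map lam [1..<Suc m]"
  let ?W = "\<lambda>r k. weight x n k * x k ^ r"
  let ?K = "\<lambda>y z :: 'a. (z - y) / (z + y)" and ?Kx = "\<lambda>k l. (x l - x k) / (x l + x k)"
  have nonzero: "sorted_wrt (\<lambda>y z. y + z \<noteq> 0) (map x s)" if "set s \<subseteq> {1..n}" for s
    using that gen
    by (auto simp: sorted_wrt_iff_nth_less generic_points_def subset_iff)
  have avg: "weighted_sum {1..n} (map ?W ss) (pfaffian ?Kx) = pfaffian (Q_entry x n) (map Some ss)" for ss
    by (simp only: weighted_sum_pfaffian pfaffian_map Q_entry.simps double_power_sum_weight[OF gen])
  have "weighted_sum {1..n} (map ?W ?rs) (\<lambda>s. pair_prod ?K (map x s)) =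
      pfaffian (Q_entry x n) (pad_even ?rs)"
  proof (cases "even m")
    case True
    have "weighted_sum {1..n} (map ?W ?rs) (\<lambda>s. pair_prod ?K (map x s)) =
        weighted_sum {1..n} (map ?W ?rs) (pfaffian ?Kx)"
    proof (rule weighted_sum_cong)
      fix s assume "length s = length (map ?W ?rs)" "set s \<subseteq> {1..n}"
      then show "pair_prod ?K (map x s) = pfaffian ?Kx s"
        using True schur_pfaffian[of "map x s"] nonzero[of s] by (simp add: pfaffian_map)
    qed
    then show ?thesis
      using True by (simp only: avg) (simp add: pad_even_def)
  next
    case False
    have "weighted_sum {1..n} (map ?W ?rs) (\<lambda>s. pair_prod ?K (map x s)) =
        weighted_sum {1..n} (map ?W ?rs)
          (\<lambda>s. \<Sum>j<length s. (-1) ^ j * (\<lambda>_. 1) (s ! j) * pfaffian ?Kx (drop_nth j s))"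
    proof (rule weighted_sum_cong)
      fix s assume len: "length s = length (map ?W ?rs)" and s: "set s \<subseteq> {1..n}"
      have x: "x k \<noteq> 0" if "k \<in> set s" for k
        using that s gen unfolding generic_points_def by (metis add_0 subsetD)
      then have "(\<Prod>z\<leftarrow>map x s. ?K 0 z) = 1"
        by (induction s) auto
      then have "pair_prod ?K (map x s) = pair_prod ?K (0 # map x s)"
        by simp
      also have "\<dots> = pfaffian ?K (0 # map x s)"
        using False len x nonzero[OF s] by (intro schur_pfaffian) (auto simp del: upt_Suc)
      also have "\<dots> = (\<Sum>j<length s. (-1) ^ j * pfaffian ?Kx (drop_nth j s))"
        using x by (auto simp: pfaffian_map map_drop_nth[symmetric] intro!: sum.cong)
      finally show "pair_prod ?K (map x s) =
          (\<Sum>j<length s. (-1) ^ j * (\<lambda>_. 1) (s ! j) * pfaffian ?Kx (drop_nth j s))"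
        by simp
    qed
    also have "\<dots> = (\<Sum>j<length ?rs. (-1) ^ j * (\<Sum>l\<in>{1..n}. ?W (?rs ! j) l * 1) *
        weighted_sum {1..n} (map ?W (drop_nth j ?rs)) (pfaffian ?Kx))"
      by (rule trans[OF weighted_sum_pfaffian_step[where h = "\<lambda>_. 1"]], intro sum.cong)
        (simp_all add: map_drop_nth del: upt_Suc map_map One_nat_def)
    also have "\<dots> = (\<Sum>j<length ?rs. (-1) ^ j * schur_q x n (?rs ! j) *
        pfaffian (Q_entry x n) (map Some (drop_nth j ?rs)))"
      by (simp only: mult_1_right power_sum_weight[OF gen] avg)
    also have "\<dots> = pfaffian (Q_entry x n) (pad_even ?rs)"
      using False
      by (auto simp: pad_even_def map_drop_nth simp del: upt_Suc map_map intro!: sum.cong)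
    finally show ?thesis .
  qed
  then show ?thesis
    by (simp only: coset_sum_eq_weighted_sum[OF gen \<open>m \<le> n\<close>] map_map comp_def)
qed

section \<open>The polynomials \<open>f\<^sub>k\<close> up to normalisation\<close>

text \<open>
  \<open>cayley_coeff k x\<close> is the coefficient of \<open>u\<^bsup>k-1\<^esup>\<close> in
  \<open>(1 + u)\<^bsup>x-1\<^esup> / (1 - u)\<^bsup>x+1\<^esup>\<close>; the recursion is the differential equation of that series.
\<close>

fun cayley_coeff :: "nat \<Rightarrow> real \<Rightarrow> real" where
  "cayley_coeff 0 x = 0"
| "cayley_coeff (Suc 0) x = 1"
| "cayley_coeff (Suc (Suc k)) x = 2 * x / (k + 1) * cayley_coeff (Suc k) x + cayley_coeff k x"

lemma cayley_coeff_at_0: "cayley_coeff k 0 = (1 - (-1) ^ k) / 2"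
  by (induction k "0 :: real" rule: cayley_coeff.induct) auto

text \<open>
  If \<open>G(x)\<close> is the generating series, then \<open>H = (1 + u) G(x) = (1 - u) G(x + 1)\<close>. The first identity
  compares coefficients here, the second one in \<open>H' = x G(x) + (x + 1) G(x + 1)\<close>. Each of them needs
  the other in the induction.
\<close>

lemma cayley_coeff_shift:
  "cayley_coeff (Suc k) (x + 1) - cayley_coeff k (x + 1) = cayley_coeff (Suc k) x + cayley_coeff k x"
  "(x + 1) * cayley_coeff (Suc k) (x + 1) =
     (x + k + 1) * cayley_coeff (Suc k) x + (k + 1) * cayley_coeff k x"
proof (induction k)
  case (Suc k)
  let ?p = "cayley_coeff (Suc k) x" and ?p' = "cayley_coeff k x"
  let ?P = "cayley_coeff (Suc k) (x + 1)" and ?P' = "cayley_coeff k (x + 1)"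
  let ?q = "cayley_coeff (Suc (Suc k)) x" and ?Q = "cayley_coeff (Suc (Suc k)) (x + 1)"
  have q: "(k + 1) * ?q = 2 * x * ?p + (k + 1) * ?p'"
    by (simp add: field_simps)
  have Q: "(k + 1) * ?Q = 2 * ((x + 1) * ?P) + (k + 1) * ?P'"
    by (simp add: field_simps)
  have P': "?P' = ?P - ?p - ?p'"
    using Suc(1) by simp
  have "(k + 1) * (?Q - ?P) = (k + 1) * (?q + ?p)"
    unfolding right_diff_distrib distrib_left Q q Suc(2) P' by (simp add: algebra_simps)
  then show 1: "?Q - ?P = ?q + ?p"
    by (metis mult_left_cancel of_nat_eq_0_iff Suc_eq_plus1 nat.distinct(1) of_nat_Suc add.commute)
  have "(x + 1) * ?Q = (x + 1) * ?P + (x + 1) * (?q + ?p)"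
    using 1 by (simp add: algebra_simps)
  then show "(x + 1) * ?Q = (x + real (Suc k) + 1) * ?q + (real (Suc k) + 1) * ?p"
    using q Suc(2) by (simp add: algebra_simps del: cayley_coeff.simps)
qed auto

text \<open>
  The binomial transform of a sequence with a two-term recurrence satisfies a three-term
  recurrence. Here this gives the contiguous relation in the first parameter of the series.
\<close>

lemma binomial_transform_recurrence:
  fixes c :: "nat \<Rightarrow> real"
  assumes c: "\<And>j. (real j + 2) * c (Suc j) = - 2 * (real j + 1 - x) * c j"
  defines "S \<equiv> \<lambda>k. \<Sum>j\<le>k. (k choose j) * c j"
  shows "(k + 3) * S (Suc (Suc k)) = 2 * x * S (Suc k) + (k + 1) * S k"
proof -
  let ?k = "Suc k"
  have S: "S i = (\<Sum>j\<le>Suc ?k. (i choose j) * c j)" if "i \<le> Suc ?k" for i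
    unfolding S_def using that by (intro sum.mono_neutral_left) (auto simp: binomial_eq_0)
  have binom_0: "(k + 3) * real (Suc ?k choose 0) - 2 * x * real (?k choose 0) - (k + 1) * real (k choose 0)
      = 2 * (1 - x) * real (?k choose 0)"
    by simp
  have binom_Suc: "(k + 3) * real (Suc ?k choose Suc j) - 2 * x * real (?k choose Suc j) -
        (k + 1) * real (k choose Suc j) =
      (real j + 2) * real (?k choose j) + 2 * (real (Suc j) + 1 - x) * real (?k choose Suc j)" for j
  proof -
    have 1: "(real j + 1) * (?k choose Suc j) = (real k + 1) * (k choose j)"
      using arg_cong[OF Suc_times_binomial[of j k], of real] by (simp add: algebra_simps)
    have 2: "(real j + 1) * (Suc ?k choose Suc j) = (real k + 2) * (?k choose j)"
      using arg_cong[OF Suc_times_binomial[of j ?k], of real] by (simp add: algebra_simps)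
    show ?thesis
      using 1 2 by (simp add: algebra_simps)
  qed
  have "(k + 3) * S (Suc ?k) - 2 * x * S ?k - (k + 1) * S k =
    (\<Sum>j\<le>Suc ?k. ((k + 3) * real (Suc ?k choose j) - 2 * x * real (?k choose j) -
       (k + 1) * real (k choose j)) * c j)"
    by (simp only: S le_Suc_eq simp_thms order.refl)
       (simp only: sum_distrib_left sum_subtractf[symmetric] left_diff_distrib mult.assoc)
  also have "\<dots> = 2 * (1 - x) * c 0 + (\<Sum>j\<le>?k. (real j + 2) * c (Suc j) * real (?k choose j)) +
      (\<Sum>j\<le>?k. 2 * (real (Suc j) + 1 - x) * c (Suc j) * real (?k choose Suc j))"
    unfolding sum.atMost_Suc_shift[of _ ?k] binom_0 binom_Suc
    by (simp only: add.assoc sum.distrib[symmetric] of_nat_1 binomial_n_0 mult_1_right)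
       (rule arg_cong2[of _ _ _ _ "(+)", OF refl], rule sum.cong, simp_all add: algebra_simps)
  also have "2 * (1 - x) * c 0 + (\<Sum>j\<le>?k. (real j + 2) * c (Suc j) * real (?k choose j)) +
      (\<Sum>j\<le>?k. 2 * (real (Suc j) + 1 - x) * c (Suc j) * real (?k choose Suc j)) =
    (\<Sum>j\<le>?k. (real j + 2) * c (Suc j) * real (?k choose j)) +
      (\<Sum>j\<le>?k. 2 * (real j + 1 - x) * c j * real (?k choose j))"
  proof -
    have "(\<Sum>j\<le>?k. 2 * (real j + 1 - x) * c j * real (?k choose j)) =
          (\<Sum>j\<le>Suc ?k. 2 * (real j + 1 - x) * c j * real (?k choose j))"
      by (intro sum.mono_neutral_left) (auto simp: binomial_eq_0)
    then show ?thesis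
      by (simp only: sum.atMost_Suc_shift) simp
  qed
  also have "\<dots> = (\<Sum>j\<le>?k. ((real j + 2) * c (Suc j) - - 2 * (real j + 1 - x) * c j) * (?k choose j))"
    by (simp only: sum.distrib[symmetric]) (rule sum.cong, simp_all add: algebra_simps)
  also have "\<dots> = 0"
    by (simp only: c) simp
  finally show ?thesis by simp
qed

text \<open>
  The hypergeometric sum is the binomial transform of the sequence
  \<open>(-2)\<^sup>j (1 - x) \<cdots> (j - x) / (j + 1)!\<close>, so it has the recursion of \<open>cayley_coeff\<close>.
\<close>

lemma f_poly_eq_cayley_coeff: "f_poly k x = fact k / 2 ^ k * cayley_coeff (Suc k) x"
proof -
  define c where "c j = (-2) ^ j * pochhammer (1 - x) j / fact (Suc j)" for j
  define S where "S = (\<lambda>k. \<Sum>j\<le>k. (k choose j) * c j)"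
  have "pochhammer (- real k) j * pochhammer (1 - x) j / (pochhammer 2 j * fact j) * 2 ^ j =
      (k choose j) * c j" for j
  proof -
    have "pochhammer (2 :: real) j = fact (Suc j)"
      by (simp add: pochhammer_fact pochhammer_rec)
    moreover have "pochhammer (- real k) j = (-1) ^ j * fact j * (k choose j)"
      by (simp add: binomial_gbinomial gbinomial_pochhammer flip: power_add mult.assoc)
    moreover have "(-2 :: real) ^ j = (-1) ^ j * 2 ^ j"
      by (simp flip: power_mult_distrib)
    ultimately show ?thesis
      by (simp only: c_def) (simp add: mult_ac del: fact_Suc)
  qed
  then have f: "f_poly k x = fact (k + 1) / 2 ^ k * S k"
    by (simp add: f_poly_eq_sum S_def atMost_atLeast0)
  have c_rec: "(real j + 2) * c (Suc j) = - 2 * (real j + 1 - x) * c j" for j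
  proof -
    have "real j + 2 \<noteq> 0" by linarith
    then show ?thesis
      by (simp add: c_def pochhammer_Suc fact_Suc[of "Suc j"] add.commute[of 2] del: fact_Suc)
        (simp add: field_simps del: fact_Suc)
  qed
  have "(real k + 1) * S k = cayley_coeff (Suc k) x" for k
  proof (induction k rule: induct_nat_012)
    case (ge2 k)
    have "(real (Suc (Suc k)) + 1) * S (Suc (Suc k)) = 2 * x * S (Suc k) + (k + 1) * S k"
      using binomial_transform_recurrence[OF c_rec, of k] by (simp add: S_def add_ac)
    also have "\<dots> = cayley_coeff (Suc (Suc (Suc k))) x"
    proof -
      have "cayley_coeff (Suc (Suc (Suc k))) x =
          2 * x / (real (Suc k) + 1) * ((real (Suc k) + 1) * S (Suc k)) + (real k + 1) * S k"
        using ge2 by (simp only: cayley_coeff.simps(3)[of "Suc k"] of_nat_add of_nat_1)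
      moreover have "real (Suc k) + 1 \<noteq> 0" by linarith
      ultimately show ?thesis by simp
    qed
    finally show ?case by simp
  qed (auto simp: S_def c_def field_simps)
  then have "cayley_coeff (Suc k) x = (real k + 1) * S k" ..
  then show ?thesis
    by (simp add: f algebra_simps del: cayley_coeff.simps)
qed

section \<open>Change of columns\<close>

text \<open>
  Coefficients of \<open>x\<^sup>c cayley_coeff (N + c + 2 j) x\<close> with respect to the functions
  \<open>x\<^sup>d cayley_coeff (N + d) x\<close>, obtained by using the recursion of \<open>cayley_coeff\<close> to lower the index.
\<close>

fun diagonal_coeff :: "nat \<Rightarrow> nat \<Rightarrow> nat \<Rightarrow> nat \<Rightarrow> real" where
  "diagonal_coeff N c 0 d = (if d = c then 1 else 0)"
| "diagonal_coeff N c (Suc j) d =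
     diagonal_coeff N c j d + 2 / (N + c + 2 * j + 1) * diagonal_coeff N (Suc c) j d"

lemma diagonal_coeff_below: "d < c \<Longrightarrow> diagonal_coeff N c j d = 0"
  by (induction N c j d rule: diagonal_coeff.induct) auto

lemma diagonal_coeff_above: "c + j < d \<Longrightarrow> diagonal_coeff N c j d = 0"
  by (induction N c j d rule: diagonal_coeff.induct) auto

lemma diagonal_coeff_first: "diagonal_coeff N c j c = 1"
  by (induction j) (auto simp: diagonal_coeff_below)

lemma diagonal_coeff_last:
  "diagonal_coeff N c j (c + j) = 2 ^ j * fact (N + c + j - 1) / fact (N + c + 2 * j - 1)"
proof (induction j arbitrary: c)
  case (Suc j)
  have "diagonal_coeff N c (Suc j) (c + Suc j) =
      2 / (N + c + 2 * j + 1) * diagonal_coeff N (Suc c) j (Suc c + j)"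
    by (simp add: diagonal_coeff_above)
  also have "\<dots> = 2 / (N + c + 2 * j + 1) * (2 ^ j * fact (N + c + j) / fact (N + c + 2 * j))"
    by (subst Suc.IH) simp
  also have "\<dots> = 2 ^ Suc j * fact (N + c + j) / (real (N + c + 2 * j + 1) * fact (N + c + 2 * j))"
    by (simp only: times_divide_times_eq power_Suc mult.assoc)
  also have "real (N + c + 2 * j + 1) * fact (N + c + 2 * j) = (fact (N + c + 2 * Suc j - 1) :: real)"
    by simp
  finally show ?case by (simp only: add_Suc_right diff_Suc_1)
qed simp

text \<open>
  \<open>diagonal_coeff_below\<close> and \<open>diagonal_coeff_above\<close> make this expansion triangular in both directions;
  \<open>diagonal_coeff_first\<close> and \<open>diagonal_coeff_last\<close> are the diagonal entries.
\<close>

lemma diagonal_coeff_expansion: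
  assumes "c + j < m"
  shows "x ^ c * cayley_coeff (N + c + 2 * j) x =
           (\<Sum>d<m. x ^ d * cayley_coeff (N + d) x * diagonal_coeff N c j d)"
  using assms
proof (induction j arbitrary: c)
  case (Suc j)
  have "x ^ c * cayley_coeff (N + c + 2 * Suc j) x =
      x ^ c * cayley_coeff (N + c + 2 * j) x +
      2 / (N + c + 2 * j + 1) * (x ^ Suc c * cayley_coeff (N + Suc c + 2 * j) x)"
    by (simp add: field_simps)
  also have "\<dots> = (\<Sum>d<m. x ^ d * cayley_coeff (N + d) x * diagonal_coeff N c j d) +
      2 / (N + c + 2 * j + 1) *
        (\<Sum>d<m. x ^ d * cayley_coeff (N + d) x * diagonal_coeff N (Suc c) j d)"
    using Suc.prems by (simp only: Suc.IH)
  also have "\<dots> = (\<Sum>d<m. x ^ d * cayley_coeff (N + d) x * diagonal_coeff N c (Suc j) d)"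
    by (simp add: sum_distrib_left flip: sum.distrib) (simp add: algebra_simps)
  finally show ?case .
qed (simp add: if_distrib cong: if_cong)

text \<open>
  Both determinants are compared with the one of the functions \<open>x\<^sup>d cayley_coeff (N + d) x\<close> for
  \<open>N = n - m + 1\<close>: the change of columns is upper triangular for the first and lower unitriangular
  for the second.
\<close>

lemma rowdet_cayley_coeff_reduction:
  assumes "length xs \<le> n"
  defines "m \<equiv> length xs"
  shows "rowdet (\<lambda>x c. cayley_coeff (n - m + 1 + 2 * c) x) xs =
    (\<Prod>c<m. 2 ^ c * fact (n - m + c) / fact (n - m + 2 * c)) *
    rowdet (\<lambda>x c. x ^ c * cayley_coeff (if even (m - 1 - c) then n else n - 1) x) xs"
proof -
  let ?N = "n - m + 1"
  let ?\<psi> = "\<lambda>x d. x ^ d * cayley_coeff (?N + d) x"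
  have "rowdet (\<lambda>x c. cayley_coeff (?N + 2 * c) x) xs =
      rowdet ?\<psi> xs * (\<Prod>c<m. diagonal_coeff ?N 0 c c)"
    unfolding m_def
    by (rule rowdet_upper_columns[where T = "\<lambda>d c. diagonal_coeff (n - length xs + 1) 0 c d"])
       (use diagonal_coeff_expansion[of 0 _ "length xs" _ "n - length xs + 1"] in
         \<open>simp_all add: diagonal_coeff_above del: One_nat_def add_Suc add_Suc_right Suc_eq_plus1\<close>)
  moreover have "diagonal_coeff ?N 0 c c = 2 ^ c * fact (n - m + c) / fact (n - m + 2 * c)" for c
    using diagonal_coeff_last[of ?N 0 c] by simp
  moreover have "rowdet (\<lambda>x c. x ^ c * cayley_coeff (if even (m - 1 - c) then n else n - 1) x) xs =
      rowdet ?\<psi> xs * (\<Prod>c<m. diagonal_coeff ?N c ((m - 1 - c) div 2) c)"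
    unfolding m_def
  proof (rule rowdet_lower_columns
      [where T = "\<lambda>d c. diagonal_coeff (n - length xs + 1) c ((length xs - 1 - c) div 2) d"])
    fix x c assume "c < length xs"
    moreover from this have "(if even (length xs - 1 - c) then n else n - 1) =
        n - length xs + 1 + c + 2 * ((length xs - 1 - c) div 2)"
      using assms(1) by (auto elim!: evenE oddE)
    moreover have "c + (length xs - 1 - c) div 2 < length xs"
      using \<open>c < length xs\<close> by linarith
    ultimately show "x ^ c * cayley_coeff (if even (length xs - 1 - c) then n else n - 1) x =
        (\<Sum>d<length xs. x ^ d * cayley_coeff (n - length xs + 1 + d) x *
           diagonal_coeff (n - length xs + 1) c ((length xs - 1 - c) div 2) d)"
      by (simp only: diagonal_coeff_expansion)
  qed (simp add: diagonal_coeff_below)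
  ultimately show ?thesis
    by (simp add: diagonal_coeff_first)
qed

section \<open>Polynomiality and specialisation at \<open>1\<close>\<close>

text \<open>
  The recursions use ring operations only and therefore commute with ring homomorphisms. The two that
  matter are the embedding into the field of fractions and the evaluation.
\<close>

lemma (in comm_ring_hom) hom_schur_q: "hom (schur_q x n r) = schur_q (\<lambda>i. hom (x i)) n r"
  by (induction x n r rule: schur_q.induct) (simp_all add: hom_distribs)

lemma (in comm_ring_hom) hom_schur_q2: "hom (schur_q2 x n a b) = schur_q2 (\<lambda>i. hom (x i)) n a b"
  by (induction x n a b rule: schur_q2.induct) (simp_all add: hom_distribs hom_schur_q)

lemma (in comm_ring_hom) hom_Q_entry: "hom (Q_entry x n u v) = Q_entry (\<lambda>i. hom (x i)) n u v"
  by (cases "(x, n, u, v)" rule: Q_entry.cases) (simp_all add: hom_schur_q hom_schur_q2)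

definition eval_monomial :: "(nat \<Rightarrow> real) \<Rightarrow> (nat \<Rightarrow>\<^sub>0 nat) \<Rightarrow> real" where
  "eval_monomial a e = (\<Prod>i\<in>Poly_Mapping.keys e. a i ^ Poly_Mapping.lookup e i)"

lemma eval_monomial_add: "eval_monomial a (d + e) = eval_monomial a d * eval_monomial a e"
proof -
  let ?S = "Poly_Mapping.keys d \<union> Poly_Mapping.keys e"
  have "eval_monomial a f = (\<Prod>i\<in>?S. a i ^ Poly_Mapping.lookup f i)"
    if "Poly_Mapping.keys f \<subseteq> ?S" for f
    unfolding eval_monomial_def
    by (rule prod.mono_neutral_left[OF _ that]) (auto simp: in_keys_iff)
  from this[of d] this[of e] this[of "d + e"] show ?thesis
    using Poly_Mapping.keys_add[of d e] by (simp add: lookup_add power_add prod.distrib)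
qed

lemma eval_rpoly_superset:
  assumes "finite S" and "Poly_Mapping.keys p \<subseteq> S"
  shows "eval_rpoly p a = (\<Sum>e\<in>S. Poly_Mapping.lookup p e * eval_monomial a e)"
  unfolding eval_rpoly_def eval_monomial_def
  by (rule sum.mono_neutral_left[OF assms]) (auto simp: in_keys_iff)

lemma eval_rpoly_add: "eval_rpoly (p + q) a = eval_rpoly p a + eval_rpoly q a"
proof -
  let ?S = "Poly_Mapping.keys p \<union> Poly_Mapping.keys q"
  show ?thesis
    using Poly_Mapping.keys_add[of p q]
    by (simp add: eval_rpoly_superset[of ?S] lookup_add sum.distrib distrib_right)
qed

lemma eval_rpoly_single: "eval_rpoly (Poly_Mapping.single e c) a = c * eval_monomial a e"
  by (subst eval_rpoly_superset[of "{e}"]) auto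

lemma eval_rpoly_sum: "eval_rpoly (\<Sum>i\<in>A. f i) a = (\<Sum>i\<in>A. eval_rpoly (f i) a)"
  by (induction A rule: infinite_finite_induct)
    (simp_all add: eval_rpoly_add eval_rpoly_superset[of "{}"])

lemma rpoly_eq_sum_monomials:
  "p = (\<Sum>e\<in>Poly_Mapping.keys p. Poly_Mapping.single e (Poly_Mapping.lookup p e))" for p :: rpoly
  by (rule poly_mapping_eqI)
    (auto simp: lookup_sum lookup_single when_def in_keys_iff)

lemma eval_rpoly_mult: "eval_rpoly (p * q) a = eval_rpoly p a * eval_rpoly q a"
proof -
  have "p * q = (\<Sum>d\<in>Poly_Mapping.keys p. \<Sum>e\<in>Poly_Mapping.keys q.
      Poly_Mapping.single (d + e) (Poly_Mapping.lookup p d * Poly_Mapping.lookup q e))"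
    by (subst (1) rpoly_eq_sum_monomials[of p], subst (1) rpoly_eq_sum_monomials[of q])
      (simp add: sum_product mult_single)
  then have "eval_rpoly (p * q) a = (\<Sum>d\<in>Poly_Mapping.keys p. \<Sum>e\<in>Poly_Mapping.keys q.
      (Poly_Mapping.lookup p d * eval_monomial a d) * (Poly_Mapping.lookup q e * eval_monomial a e))"
    by (simp add: eval_rpoly_sum eval_rpoly_single eval_monomial_add mult_ac)
  then show ?thesis
    by (simp add: sum_product eval_rpoly_superset[of "Poly_Mapping.keys p" p]
        eval_rpoly_superset[of "Poly_Mapping.keys q" q])
qed

lemma comm_ring_hom_eval_rpoly: "comm_ring_hom (\<lambda>p. eval_rpoly p a)"
proof
  have "eval_rpoly (Poly_Mapping.single 0 1) a = 1"
    by (simp only: eval_rpoly_single) (simp add: eval_monomial_def)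
  then show "eval_rpoly 1 a = 1"
    by simp
qed (simp_all add: eval_rpoly_add eval_rpoly_mult eval_rpoly_superset[of "{}"])

lemma eval_rpoly_Var: "eval_rpoly (Var i) a = a i"
  by (simp add: Var_def eval_rpoly_single eval_monomial_def)

lemma comm_ring_hom_to_fract: "comm_ring_hom (to_fract :: 'a :: idom \<Rightarrow> 'a fract)"
  by unfold_locales simp_all

lemma generic_points_Var: "generic_points (\<lambda>i. to_fract (Var i)) n"
  unfolding generic_points_def
proof (intro conjI inj_onI ballI)
  fix i j assume "to_fract (Var i) = to_fract (Var j)"
  then have "eval_rpoly (Var i) real = eval_rpoly (Var j) real"
    by simp
  then show "i = j"
    by (simp add: eval_rpoly_Var)
next
  fix i j
  have "eval_rpoly (Var i + Var j) (\<lambda>_. 1) \<noteq> eval_rpoly 0 (\<lambda>_. 1)"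
    by (simp add: eval_rpoly_add eval_rpoly_Var eval_rpoly_superset[of "{}" 0])
  then have "Var i + Var j \<noteq> 0"
    by metis
  then show "to_fract (Var i) + to_fract (Var j) \<noteq> 0"
    by (metis to_fract_add to_fract_eq_0_iff)
qed

text \<open>
  The entries of the Pfaffian are given by recursions without division. So it is a polynomial, and
  it may be specialised although the summands of the definition may not.
\<close>

theorem schur_Q_eq_pfaffian:
  assumes "m \<le> n"
  shows "schur_Q m n lam = pfaffian (Q_entry Var n) (pad_even (map lam [1..<Suc m]))"
proof -
  let ?P = "pfaffian (Q_entry Var n) (pad_even (map lam [1..<Suc m]))"
  interpret fract: comm_ring_hom "to_fract :: rpoly \<Rightarrow> rpoly fract"
    by (rule comm_ring_hom_to_fract)
  have "to_fract ?P = schur_Q_fract m n lam"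
    unfolding schur_Q_fract_def coset_sum_eq_pfaffian[OF generic_points_Var assms]
    by (simp only: fract.hom_pfaffian fract.hom_Q_entry)
  then show ?thesis
    unfolding schur_Q_def by (metis (mono_tags, lifting) the_equality to_fract_eq_iff)
qed

corollary eval_schur_Q:
  assumes "m \<le> n"
  shows "eval_rpoly (schur_Q m n lam) a = pfaffian (Q_entry a n) (pad_even (map lam [1..<Suc m]))"
proof -
  interpret eval: comm_ring_hom "\<lambda>p. eval_rpoly p a"
    by (rule comm_ring_hom_eval_rpoly)
  show ?thesis
    by (simp only: schur_Q_eq_pfaffian[OF assms] eval.hom_pfaffian eval.hom_Q_entry eval_rpoly_Var)
qed

lemma schur_q_at_1: "schur_q (\<lambda>_. 1) n r = 2 * cayley_coeff n (real r)"
proof (induction "\<lambda>_ :: nat. 1 :: real" n r rule: schur_q.induct)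
  case (3 n r)
  then show ?case
    using cayley_coeff_shift(1)[of n "real r"] by (simp add: add.commute del: cayley_coeff.simps)
qed (simp_all add: cayley_coeff_at_0)

text \<open>
  The recursion of \<open>schur_q2\<close> keeps \<open>a + b\<close> constant, so the claim can be checked after multiplication
  by it. The check uses both identities of \<open>cayley_coeff_shift\<close>, at \<open>a\<close> and at \<open>b\<close>.
\<close>

lemma schur_q2_at_1:
  "(real a + real b) * schur_q2 (\<lambda>_. 1) (Suc k) a b =
     4 * (real a * cayley_coeff (Suc k) (real a) * cayley_coeff k (real b) -
          real b * cayley_coeff (Suc k) (real b) * cayley_coeff k (real a))"
proof (induction a arbitrary: b)
  case 0
  show ?case
    by (simp add: schur_q_at_1 cayley_coeff_at_0 del: cayley_coeff.simps)
      (simp only: algebra_simps)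
next
  case (Suc a)
  define p p' P P' s s' S S' where
    "p = cayley_coeff (Suc k) (real a)" and "p' = cayley_coeff k (real a)" and
    "P = cayley_coeff (Suc k) (real (Suc a))" and "P' = cayley_coeff k (real (Suc a))" and
    "s = cayley_coeff (Suc k) (real b)" and "s' = cayley_coeff k (real b)" and
    "S = cayley_coeff (Suc k) (real (Suc b))" and "S' = cayley_coeff k (real (Suc b))"
  note defs = this
  have P': "P' = P - p - p'" and P: "(real a + 1) * P = (real a + k + 1) * p + (k + 1) * p'"
    using cayley_coeff_shift[where k = k and x = "real a"] by (simp_all add: defs add.commute del: cayley_coeff.simps)
  have S': "S' = S - s - s'" and S: "(real b + 1) * S = (real b + k + 1) * s + (k + 1) * s'"
    using cayley_coeff_shift[where k = k and x = "real b"] by (simp_all add: defs add.commute del: cayley_coeff.simps)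
  have IH: "(real a + real (Suc b)) * schur_q2 (\<lambda>_. 1) (Suc k) a (Suc b) =
      4 * (real a * p * S' - real (Suc b) * S * p')"
    using Suc.IH[of "Suc b"] by (simp only: defs)
  have "(real (Suc a) + real b) * schur_q2 (\<lambda>_. 1) (Suc k) (Suc a) b =
      4 * (real a + real b + 1) * (p * S - P * s) -
      (real a + real (Suc b)) * schur_q2 (\<lambda>_. 1) (Suc k) a (Suc b)"
    by (simp only: schur_q2.simps schur_q_at_1 defs of_nat_Suc) (simp only: algebra_simps)
  also have "\<dots> = 4 * ((real a + real b + 1) * (p * S - P * s) -
      (real a * p * S' - real (Suc b) * S * p'))"
    by (simp only: IH) (simp only: algebra_simps)
  also have "(real a + real b + 1) * (p * S - P * s) - (real a * p * S' - real (Suc b) * S * p') =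
      (real a + 1) * P * s' - real b * s * P' +
      (((real b + 1) * S) * (p + p') - ((real a + 1) * P) * (s + s') +
        real a * p * (s + s') - real b * s * (p + p'))"
    unfolding P' S' of_nat_Suc by (simp only: algebra_simps)
  also have "((real b + 1) * S) * (p + p') - ((real a + 1) * P) * (s + s') +
        real a * p * (s + s') - real b * s * (p + p') = 0"
    unfolding P S by (simp add: algebra_simps)
  finally show ?case
    by (simp add: defs mult_ac add_ac del: cayley_coeff.simps schur_q2.simps)
qed

section \<open>Evaluation of the Pfaffian\<close>

definition entry_row :: "nat \<Rightarrow> nat option \<Rightarrow> real \<times> real \<times> real" where
  "entry_row k u = (case u of None \<Rightarrow> (0, -1/2, 0)
     | Some r \<Rightarrow> (r, cayley_coeff k r, r * cayley_coeff (Suc k) r))"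

text \<open>
  After the specialisation each entry is a multiple of a \<open>2 \<times> 2\<close> minor over \<open>x + y\<close>, so the
  Pfaffian is a two-block determinant. The row for \<open>None\<close> is chosen to fit this pattern; it makes
  the matrix block triangular when \<open>m\<close> is odd.
\<close>

lemma pfaffian_at_1:
  assumes pos: "\<forall>r\<in>set rs. 0 < r"
  defines "m \<equiv> length rs" and "xs \<equiv> map real rs"
  shows "pfaffian (Q_entry (\<lambda>_. 1) (Suc k)) (pad_even rs) * pair_prod (+) xs =
    (-1) ^ (m div 2) * 2 ^ m *
    rowdet (\<lambda>x c. x ^ c * cayley_coeff (if even (m - 1 - c) then Suc k else k) x) xs"
proof -
  let ?row = "entry_row k" and ?s = "\<lambda>y z :: real \<times> real \<times> real. fst y + fst z"
  let ?M = "\<lambda>y z. minor2 y z / ?s y z"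
  let ?us = "pad_even rs"
  let ?\<phi> = "\<lambda>x c. x ^ c * cayley_coeff (if even (m - 1 - c) then Suc k else k) x"
  let ?some = "\<lambda>r. (real r, cayley_coeff k r, r * cayley_coeff (Suc k) r)"
  have row_Some: "?row (Some r) = ?some r" for r
    by (simp add: entry_row_def)
  have "sorted_wrt (\<lambda>u v. 0 < ?s (?row u) (?row v) \<and> Q_entry (\<lambda>_. 1) (Suc k) u v = - 4 * ?M (?row u) (?row v)) ?us"
  proof -
    have "Q_entry (\<lambda>_. 1) (Suc k) (Some a) (Some b) = - 4 * ?M (?row (Some a)) (?row (Some b))"
      if "0 < a" "0 < b" for a b
    proof -
      have "real a + real b \<noteq> 0" using that by linarith
      then show ?thesis
        using schur_q2_at_1[of a b k]
        by (simp add: entry_row_def minor2_def field_simps del: cayley_coeff.simps schur_q2.simps)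
    qed
    moreover have "Q_entry (\<lambda>_. 1) (Suc k) None (Some b) = - 4 * ?M (?row None) (?row (Some b))"
      if "0 < b" for b
      using that by (simp add: entry_row_def minor2_def schur_q_at_1 del: cayley_coeff.simps)
    moreover have "fst (?row (Some a)) = real a" "fst (?row None) = 0" for a
      by (simp_all add: entry_row_def)
    moreover have "0 < rs ! i" if "i < length rs" for i
      using pos that by simp
    ultimately show ?thesis
      by (auto simp: pad_even_def sorted_wrt_iff_nth_less nth_Cons split: nat.splits
          intro!: add_pos_pos)
  qed
  then have nonzero: "sorted_wrt (\<lambda>u v. ?s (?row u) (?row v) \<noteq> 0) ?us"
    and entry: "sorted_wrt (\<lambda>u v. Q_entry (\<lambda>_. 1) (Suc k) u v = - 4 * ?M (?row u) (?row v)) ?us"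
    by (auto elim!: sorted_wrt_mono_rel[rotated])
  have even: "even (length ?us)"
    by (simp add: pad_even_def)
  have "pfaffian (Q_entry (\<lambda>_. 1) (Suc k)) ?us * pair_prod (\<lambda>u v. ?s (?row u) (?row v)) ?us =
      (-4) ^ (length ?us div 2) * (pair_prod ?s (map ?row ?us) * pfaffian ?M (map ?row ?us))"
    by (simp only: pfaffian_cong[OF entry] pfaffian_scale[OF even] pair_prod_map pfaffian_map mult_ac)
  also have "\<dots> = (-4) ^ (length ?us div 2) * rowdet two_block_row (map ?row ?us)"
    using even nonzero by (subst two_block_det_eq_pfaffian) (simp_all add: sorted_wrt_map)
  finally have pf: "pfaffian (Q_entry (\<lambda>_. 1) (Suc k)) ?us *
      pair_prod (\<lambda>u v. ?s (?row u) (?row v)) ?us =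
      (-4) ^ (length ?us div 2) * rowdet two_block_row (map ?row ?us)" .
  have sums: "pair_prod (\<lambda>u v. ?s (?row u) (?row v)) (map Some rs) = pair_prod (+) xs"
    by (simp add: pair_prod_map xs_def row_Some)
  show ?thesis
  proof (cases "even m")
    case True
    then have us: "?us = map Some rs" and m: "length ?us div 2 = m div 2"
      by (simp_all add: pad_even_def m_def)
    have "two_block_row (?some r) c = ?\<phi> (real r) c" if "c < m" for r c
      using that True by (auto simp: two_block_row_def elim!: evenE oddE)
    then have "rowdet two_block_row (map ?row ?us) = rowdet ?\<phi> xs"
      unfolding us xs_def map_map rowdet_map m_def
      by (intro rowdet_cong) (simp add: row_Some)
    moreover have "(-4 :: real) ^ (m div 2) = (-1) ^ (m div 2) * 2 ^ m"
    proof -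
      have "(2 :: real) ^ m = (2 ^ 2) ^ (m div 2)"
        using True by (metis even_two_times_div_two power_mult)
      then show ?thesis by (simp flip: power_mult_distrib)
    qed
    ultimately show ?thesis
      using pf by (simp only: us[symmetric] m) (simp only: us sums)
  next
    case False
    then have us: "?us = None # map Some rs"
      by (simp add: pad_even_def m_def)
    define h where "h = m div 2"
    have m: "m = Suc (2 * h)"
      using False by (simp add: h_def)
    have len: "length ?us div 2 = Suc h"
      by (simp add: us flip: m_def) (simp add: m)
    have r: "two_block_row (?some r) (Suc c) = real r * ?\<phi> (real r) c" if "c < m" for r c
      using that False by (auto simp: two_block_row_def elim!: evenE oddE)
    have "rowdet two_block_row (map ?row ?us) =
        rowdet two_block_row ([?row None] @ map ?some rs)"
      by (simp add: us row_Some comp_def)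
    also have "\<dots> = rowdet two_block_row [?row None] *
        rowdet (\<lambda>w c. two_block_row w (length [?row None] + c)) (map ?some rs)"
      by (rule rowdet_block_triangular)
        (auto simp: two_block_row_def entry_row_def elim!: oddE)
    also have "rowdet two_block_row [?row None] = - 1 / 2"
      by (simp add: rowdet_def det_single two_block_row_def entry_row_def)
    also have "rowdet (\<lambda>w c. two_block_row w (length [?row None] + c)) (map ?some rs) =
        rowdet (\<lambda>r c. real r * ?\<phi> (real r) c) rs"
      unfolding rowdet_map m_def by (intro rowdet_cong) (simp add: r[unfolded m_def])
    also have "\<dots> = (\<Prod>r\<leftarrow>rs. real r) * rowdet (\<lambda>r. ?\<phi> (real r)) rs"
      by (rule rowdet_scale_rows) simp
    also have "rowdet (\<lambda>r. ?\<phi> (real r)) rs = rowdet ?\<phi> xs"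
      by (simp add: xs_def rowdet_map)
    finally have det: "rowdet two_block_row (map ?row ?us) = - 1 / 2 * ((\<Prod>r\<leftarrow>rs. real r) * rowdet ?\<phi> xs)" .
    have sums': "pair_prod (\<lambda>u v. ?s (?row u) (?row v)) ?us = (\<Prod>r\<leftarrow>rs. real r) * pair_prod (+) xs"
      by (simp add: us sums[symmetric] comp_def) (simp add: entry_row_def)
    have four: "(-4 :: real) ^ Suc h * (- 1 / 2) = (-1) ^ h * 2 ^ m"
    proof -
      have "(-4 :: real) ^ h = (-1) ^ h * (2 ^ 2) ^ h"
        by (simp flip: power_mult_distrib)
      then show ?thesis by (simp add: m power_mult)
    qed
    have "(\<Prod>r\<leftarrow>rs. real r) * (pfaffian (Q_entry (\<lambda>_. 1) (Suc k)) ?us * pair_prod (+) xs) =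
        (-4) ^ Suc h * (- 1 / 2 * ((\<Prod>r\<leftarrow>rs. real r) * rowdet ?\<phi> xs))"
      using pf unfolding det len sums' by (simp only: mult.left_commute)
    also have "\<dots> = (-4) ^ Suc h * (- 1 / 2) * ((\<Prod>r\<leftarrow>rs. real r) * rowdet ?\<phi> xs)"
      by (simp only: mult.assoc)
    also have "\<dots> = (\<Prod>r\<leftarrow>rs. real r) * ((-1) ^ h * 2 ^ m * rowdet ?\<phi> xs)"
      unfolding four by (simp only: mult_ac)
    finally have "(\<Prod>r\<leftarrow>rs. real r) * (pfaffian (Q_entry (\<lambda>_. 1) (Suc k)) ?us * pair_prod (+) xs) =
        (\<Prod>r\<leftarrow>rs. real r) * ((-1) ^ h * 2 ^ m * rowdet ?\<phi> xs)" .
    moreover have "(\<Prod>r\<leftarrow>rs. real r) \<noteq> 0"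
      using pos by (auto simp: prod_list_zero_iff)
    ultimately show ?thesis
      unfolding h_def by (simp only: mult_cancel_left simp_thms)
  qed
qed

lemma neg_one_power_triangle: "(-1 :: real) ^ (m * (m - 1) div 2) = (-1) ^ (m div 2)"
proof -
  define h where "h = m div 2"
  have "m * (m - 1) div 2 = h * (2 * h - 1) \<or> m * (m - 1) div 2 = h * (2 * h + 1)"
  proof (cases "even m")
    case True
    then have "m = 2 * h" by (simp add: h_def)
    then show ?thesis by simp
  next
    case False
    then have "m = 2 * h + 1" by (simp add: h_def)
    then have "m * (m - 1) = 2 * (h * (2 * h + 1))" by simp
    then show ?thesis by simp
  qed
  then have "even (m * (m - 1) div 2) \<longleftrightarrow> even h"
    by (cases h) auto
  then show ?thesis
    by (simp add: minus_one_power_iff h_def)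
qed

lemma two_power_exponent:
  fixes m n :: nat
  assumes "m \<le> n"
  shows "m * (2 * n + 1 - m) div 2 = m + (\<Sum>c<m. n - m + c)"
proof -
  obtain d where n: "n = m + d" using le_Suc_ex[OF assms] by blast
  have "m * (2 * d + m + 1) = 2 * (m + (\<Sum>c<m. d + c))"
  proof (induction m)
    case (Suc m)
    have "(m + 1) * (2 * d + (m + 1) + 1) = m * (2 * d + m + 1) + 2 * (d + m + 1)"
      by (simp add: algebra_simps)
    also have "\<dots> = 2 * (m + 1 + (\<Sum>c<Suc m. d + c))"
      by (simp only: Suc.IH sum.lessThan_Suc) simp
    finally show ?case
      by (simp only: Suc_eq_plus1)
  qed simp
  moreover have "2 * n + 1 - m = 2 * d + m + 1" and "n - m = d"
    by (simp_all add: n)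
  ultimately show ?thesis
    by (simp only:) simp
qed

text \<open>
  Reversing the columns makes their index increase; then the column reduction applies.
\<close>

lemma det_f_poly:
  assumes "length xs \<le> n"
  defines "m \<equiv> length xs"
  shows "rowdet (\<lambda>x c. f_poly (n + m - 2 * (c + 1)) x) xs =
    (-1) ^ (m div 2) * (\<Prod>c<m. fact (n - m + c) / 2 ^ (n - m + c)) *
    rowdet (\<lambda>x c. x ^ c * cayley_coeff (if even (m - 1 - c) then n else n - 1) x) xs"
proof -
  let ?\<phi> = "\<lambda>x c. f_poly (n - m + 2 * c) x"
  let ?\<psi> = "\<lambda>x c. cayley_coeff (n - m + 1 + 2 * c) x"
  have "rowdet (\<lambda>x c. f_poly (n + m - 2 * (c + 1)) x) xs = rowdet (\<lambda>x c. ?\<phi> x (m - 1 - c)) xs"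
  proof (rule rowdet_cong)
    fix x c assume "c < length xs"
    then have "n + m - 2 * (c + 1) = n - m + 2 * (m - 1 - c)"
    proof -
      obtain e where "m = c + 1 + e"
        using \<open>c < length xs\<close> less_iff_Suc_add[of c m] by (auto simp: m_def)
      moreover obtain d where "n = m + d"
        using le_Suc_ex[OF assms(1)] unfolding m_def by blast
      ultimately show ?thesis by simp
    qed
    then show "f_poly (n + m - 2 * (c + 1)) x = ?\<phi> x (m - 1 - c)"
      by simp
  qed
  also have "\<dots> = (-1) ^ (m div 2) * rowdet ?\<phi> xs"
    using rowdet_reverse_columns[of ?\<phi> xs] by (simp only: m_def neg_one_power_triangle)
  also have "rowdet ?\<phi> xs = rowdet ?\<psi> xs * (\<Prod>c<m. fact (n - m + 2 * c) / 2 ^ (n - m + 2 * c))"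
    unfolding m_def
    by (rule trans[OF rowdet_upper_columns[where \<psi> = ?\<psi> and
            T = "\<lambda>d c. if d = c then fact (n - m + 2 * c) / 2 ^ (n - m + 2 * c) else 0"]])
      (simp_all add: f_poly_eq_cayley_coeff m_def if_distrib cong: if_cong del: cayley_coeff.simps)
  also have "rowdet ?\<psi> xs =
    (\<Prod>c<m. 2 ^ c * fact (n - m + c) / fact (n - m + 2 * c)) *
    rowdet (\<lambda>x c. x ^ c * cayley_coeff (if even (m - 1 - c) then n else n - 1) x) xs"
    unfolding m_def by (rule rowdet_cayley_coeff_reduction[OF assms(1)])
  also have "(\<Prod>c<m. 2 ^ c * fact (n - m + c) / fact (n - m + 2 * c)) *
      rowdet (\<lambda>x c. x ^ c * cayley_coeff (if even (m - 1 - c) then n else n - 1) x) xs *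
      (\<Prod>c<m. fact (n - m + 2 * c) / 2 ^ (n - m + 2 * c)) =
     (\<Prod>c<m. (2 ^ c * fact (n - m + c) / fact (n - m + 2 * c)) * (fact (n - m + 2 * c) / 2 ^ (n - m + 2 * c))) *
      rowdet (\<lambda>x c. x ^ c * cayley_coeff (if even (m - 1 - c) then n else n - 1) x) xs"
    by (simp only: prod.distrib mult_ac)
  also have "(\<Prod>c<m. (2 ^ c * fact (n - m + c) / fact (n - m + 2 * c)) *
      (fact (n - m + 2 * c) / 2 ^ (n - m + 2 * c))) =
      (\<Prod>c<m. fact (n - m + c) / 2 ^ (n - m + c) :: real)"
  proof (rule prod.cong[OF refl])
    fix c
    have "(2 :: real) ^ (n - m + 2 * c) = 2 ^ c * 2 ^ (n - m + c)"
      by (simp flip: power_add add: algebra_simps mult_2)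
    then show "(2 ^ c * fact (n - m + c) / fact (n - m + 2 * c)) *
        (fact (n - m + 2 * c) / 2 ^ (n - m + 2 * c)) = (fact (n - m + c) / 2 ^ (n - m + c) :: real)"
      by simp
  qed
  finally show ?thesis by (simp only: mult.assoc)
qed

theorem corollary5p10:
  fixes m n :: nat and lam :: "nat \<Rightarrow> nat"
  assumes "is_partition m lam" and "m \<le> n"
  shows "eval_rpoly (schur_Q m n lam) (\<lambda>i. 1) =
      2 ^ (m * (2 * n + 1 - m) div 2) *
      (\<Prod>i=1..m. 1 / fact (n - m + i - 1)) *
      (\<Prod>i=1..m. \<Prod>j\<in>{i<..m}. 1 / (real (lam i) + real (lam j))) *
      det (mat m m (\<lambda>(i, j). f_poly (n + m - 2 * (j + 1)) (real (lam (i + 1)))))"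
proof (cases n)
  \<comment> \<open>The entries involve \<open>cayley_coeff (n - 1)\<close>. For \<open>n = 0\<close> the partition is empty.\<close>
  case 0
  with assms(2) show ?thesis
    by (simp add: eval_schur_Q pad_even_def)
next
  case (Suc k)
  define rs where "rs = map lam [1..<Suc m]"
  define xs where "xs = map real rs"
  define B where
    "B = rowdet (\<lambda>x c. x ^ c * cayley_coeff (if even (m - 1 - c) then n else n - 1) x) xs"
  have len: "length rs = m" "length xs = m"
    by (simp_all add: rs_def xs_def)
  have pos: "\<forall>r\<in>set rs. 0 < r"
    using assms(1) by (auto simp: rs_def is_partition_def simp del: upt_Suc)
  have Q: "eval_rpoly (schur_Q m n lam) (\<lambda>i. 1) * pair_prod (+) xs = (-1) ^ (m div 2) * 2 ^ m * B"
    using pfaffian_at_1[OF pos, of k] eval_schur_Q[OF assms(2), of lam "\<lambda>_. 1"]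
    by (simp only: B_def Suc len diff_Suc_1 flip: rs_def xs_def)
  have xs: "xs = map (\<lambda>i. real (lam i)) [1..<Suc m]"
    by (simp add: xs_def rs_def del: upt_Suc)
  have sums: "pair_prod (+) xs = (\<Prod>i=1..m. \<Prod>j\<in>{i<..m}. real (lam i) + real (lam j))"
    unfolding xs by (rule pair_prod_upt)
  have "sorted_wrt (\<lambda>y z. y + z \<noteq> 0) xs"
    using pos by (auto simp: xs_def sorted_wrt_iff_nth_less add_nonneg_eq_0_iff)
  then have nonzero: "pair_prod (+) xs \<noteq> 0"
    by (rule pair_prod_nonzero)
  have "det (mat m m (\<lambda>(i, j). f_poly (n + m - 2 * (j + 1)) (real (lam (i + 1))))) =
      rowdet (\<lambda>x c. f_poly (n + m - 2 * (c + 1)) x) xs"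
    unfolding rowdet_def len
    by (rule arg_cong[of _ _ det], rule eq_matI) (auto simp: xs simp del: upt_Suc)
  also have "\<dots> = (-1) ^ (m div 2) * (\<Prod>c<m. fact (n - m + c) / 2 ^ (n - m + c)) * B"
    using det_f_poly[of xs n] assms(2) by (simp add: len B_def)
  finally have det: "det (mat m m (\<lambda>(i, j). f_poly (n + m - 2 * (j + 1)) (real (lam (i + 1))))) =
      (-1) ^ (m div 2) * (\<Prod>c<m. fact (n - m + c) / 2 ^ (n - m + c)) * B" .
  have const: "2 ^ (m * (2 * n + 1 - m) div 2) * (\<Prod>i=1..m. 1 / fact (n - m + i - 1)) *
      (\<Prod>c<m. fact (n - m + c) / 2 ^ (n - m + c)) = (2 ^ m :: real)"
  proof -
    have "(2 :: real) ^ (m * (2 * n + 1 - m) div 2) = 2 ^ m * (\<Prod>c<m. 2 ^ (n - m + c))"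
      by (simp only: two_power_exponent[OF assms(2)] power_add power_sum)
    moreover have "(\<Prod>i=1..m. 1 / fact (n - m + i - 1) :: real) = (\<Prod>c<m. 1 / fact (n - m + c))"
      by (simp add: prod.atLeast1_atMost_eq)
    moreover have "(\<Prod>c<m. 2 ^ (n - m + c)) * (\<Prod>c<m. 1 / fact (n - m + c)) *
        (\<Prod>c<m. fact (n - m + c) / 2 ^ (n - m + c)) = (1 :: real)"
      unfolding prod.distrib[symmetric] by simp
    ultimately show ?thesis
      by (simp only: mult.assoc mult_1_right)
  qed
  have "eval_rpoly (schur_Q m n lam) (\<lambda>i. 1) = (-1) ^ (m div 2) * 2 ^ m * B / pair_prod (+) xs"
    using Q nonzero by (simp add: eq_divide_eq)
  also have "\<dots> = (2 ^ (m * (2 * n + 1 - m) div 2) * (\<Prod>i=1..m. 1 / fact (n - m + i - 1)) *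
      (\<Prod>c<m. fact (n - m + c) / 2 ^ (n - m + c))) * (-1) ^ (m div 2) * B / pair_prod (+) xs"
    unfolding const by (simp only: mult_ac)
  also have "\<dots> = (2 ^ (m * (2 * n + 1 - m) div 2) * (\<Prod>i=1..m. 1 / fact (n - m + i - 1)) *
      (\<Prod>c<m. fact (n - m + c) / 2 ^ (n - m + c))) * (-1) ^ (m div 2) * B * (1 / pair_prod (+) xs)"
    by (simp only: times_divide_eq_right mult_1_right)
  also have "1 / pair_prod (+) xs = (\<Prod>i=1..m. \<Prod>j\<in>{i<..m}. 1 / (real (lam i) + real (lam j)))"
    unfolding sums by (simp add: prod_dividef)
  finally show ?thesis
    unfolding det by (simp only: mult_ac)
qed

end
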